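(* Let $p\ge1$ be an integer, let $X_1,\ldots,X_p$ be independent with $X_k\sim N(0,\sigma_k^2)$, $\sigma_k>0$, let $\sigma^2=\prod_{k=1}^p\sigma_k^2$ and $Y_p=\prod_{k=1}^pX_k$; the law of $Y_p$ is denoted $\mathrm{PN}(p,\sigma^2)$. Let $$\mathcal{S}_pf(y)=\sigma^2\sum_{k=1}^p{p\brace k}y^{k-1}f^{(k)}(y)-yf(y).$$ Let $W$ be a real-valued random variable. Then: (a) Let $p\in\{3,4\}$. Suppose $\mathbb{E}[|W|^{p-1}]<\infty$. Then $W\sim\mathrm{PN}(p,\sigma^2)$ if and only if $\mathbb{E}[\mathcal{S}_pf(W)]=0$ for all $f\in\mathcal{F}_{\mathcal{S}_p,Y_p}$. (b) Let $p\in\{5,6,7,8\}$. Suppose $W$ is a symmetric random variable ($W=_d-W$) such that $\mathbb{E}[|W|^{p-1}]<\infty$. Then $W\sim\mathrm{PN}(p,\sigma^2)$ if and only if $\mathbb{E}[\mathcal{S}_pf(W)]=0$ for all $f\in\mathcal{F}_{\mathcal{S}_p,Y_p}$.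
   Context: ${p\brace k}=\frac{1}{k!}\sum_{j=0}^k(-1)^{k-j}\binom{k}{j}j^p$ is a Stirling number of the second kind; equivalently $\mathcal{S}_pf(y)=\frac{\sigma^2}{y}\big(y\frac{\mathrm{d}}{\mathrm{d}y}\big)^pf(y)-yf(y)$. For a differential operator $\mathcal{S}=\sum_{t=0}^T p_t(y)\partial^t$ with polynomial coefficients, $m=\max_{0\le t\le T}\deg p_t$, and a random variable $Y$ supported on $I\subseteq\mathbb{R}$, the class $\mathcal{F}_{\mathcal{S},Y}$ is the set of all $f\in C^T(I)$ such that $\mathbb{E}|Y^jf^{(t)}(Y)|<\infty$ for all $t=0,\ldots,T$ and $j=0,\ldots,m$. This class contains the real and imaginary parts of $y\mapsto \mathrm{e}^{\mathrm{i}ty}$, $t\in\mathbb{R}$. *)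

theory Defs
  imports
    "HOL-Probability.Probability"
    "HOL-Combinatorics.Stirling"
    "HOL-Computational_Algebra.Polynomial"
begin

text \<open>
  A differential operator \<open>\<Sum>t\<le>T. c\<^sub>t(y) (d/dy)\<^sup>t\<close> with polynomial coefficients is given by its order \<open>T\<close>
  and its coefficients \<open>c :: nat \<Rightarrow> real poly\<close>; only \<open>c t\<close> with \<open>t \<le> T\<close> matters.
\<close>

definition diff_op :: "nat \<Rightarrow> (nat \<Rightarrow> real poly) \<Rightarrow> (real \<Rightarrow> real) \<Rightarrow> real \<Rightarrow> real" where
  "diff_op T c f y = (\<Sum>t\<le>T. poly (c t) y * (deriv ^^ t) f y)"

definition max_coeff_degree :: "nat \<Rightarrow> (nat \<Rightarrow> real poly) \<Rightarrow> nat" where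
  "max_coeff_degree T c = Max ((\<lambda>t. degree (c t)) ` {..T})"

text \<open>
  \<open>C\<^sup>T(\<real>)\<close>. The constant \<^term>\<open>deriv\<close> is total, so the existence of the derivatives of order
  \<open>1, \<dots>, T\<close> has to be required explicitly.
\<close>

definition continuously_differentiable :: "nat \<Rightarrow> (real \<Rightarrow> real) \<Rightarrow> bool" where
  "continuously_differentiable T f \<longleftrightarrow>
     (\<forall>t<T. \<forall>x. (deriv ^^ t) f field_differentiable (at x)) \<and>
     continuous_on UNIV ((deriv ^^ T) f)"

text \<open>
  The class \<open>\<F>\<^bsub>S,Y\<^esub>\<close> for a random variable \<open>Y\<close> on the probability space \<open>N\<close> whose support is the
  whole real line, that is \<open>I = \<real>\<close>.
\<close>

definition stein_class ::
  "nat \<Rightarrow> (nat \<Rightarrow> real poly) \<Rightarrow> 'b measure \<Rightarrow> ('b \<Rightarrow> real) \<Rightarrow> (real \<Rightarrow> real) set" where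
  "stein_class T c N Y =
     {f. continuously_differentiable T f \<and>
         (\<forall>t\<le>T. \<forall>j\<le>max_coeff_degree T c.
            integrable N (\<lambda>\<omega>. \<bar>Y \<omega> ^ j * (deriv ^^ t) f (Y \<omega>)\<bar>))}"

definition PN_coeff :: "nat \<Rightarrow> real \<Rightarrow> nat \<Rightarrow> real poly" where
  "PN_coeff p s2 k =
     (if k = 0 then - monom 1 1 else monom (s2 * real (Stirling p k)) (k - 1))"

definition PN_op :: "nat \<Rightarrow> real \<Rightarrow> (real \<Rightarrow> real) \<Rightarrow> real \<Rightarrow> real" where
  "PN_op p s2 = diff_op p (PN_coeff p s2)"

lemma PN_op_eq:
  "PN_op p s2 f y =
     s2 * (\<Sum>k=1..p. real (Stirling p k) * y ^ (k - 1) * (deriv ^^ k) f y) - y * f y"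
proof -
  have eq: "{..p} = insert 0 {1..p}"
    by auto
  have "PN_op p s2 f y =
      (\<Sum>t=1..p. poly (PN_coeff p s2 t) y * (deriv ^^ t) f y) - y * f y"
    unfolding PN_op_def diff_op_def eq by (simp add: PN_coeff_def poly_monom)
  also have "(\<Sum>t=1..p. poly (PN_coeff p s2 t) y * (deriv ^^ t) f y) =
      s2 * (\<Sum>k=1..p. real (Stirling p k) * y ^ (k - 1) * (deriv ^^ k) f y)"
    unfolding sum_distrib_left
    by (intro sum.cong) (auto simp: PN_coeff_def poly_monom)
  finally show ?thesis .
qed

lemma Stirling_explicit:
  "real (Stirling p k) = (\<Sum>j\<le>k. (-1) ^ (k - j) * real (k choose j) * real j ^ p) / fact k"
proof -
  define A :: "nat \<Rightarrow> nat \<Rightarrow> real"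
    where "A p k = (\<Sum>j\<le>k. (-1) ^ (k - j) * real (k choose j) * real j ^ p)" for p k
  have A_0: "A 0 k = 0 ^ k" for k
  proof -
    have "(1 + (-1 :: real)) ^ k = (\<Sum>j\<le>k. of_nat (k choose j) * 1 ^ j * (-1) ^ (k - j))"
      by (rule binomial_ring)
    then show ?thesis
      by (simp add: A_def mult.commute)
  qed
  have A_Suc: "A (Suc p) (Suc k) = real (Suc k) * (A p (Suc k) + A p k)" for p k
  proof -
    have choose: "real j * real (Suc k choose j) =
        real (Suc k) * (real (Suc k choose j) - real (k choose j))" for j
    proof (cases j)
      case (Suc i)
      have "real (Suc i) * real (Suc k choose Suc i) = real (Suc k) * real (k choose i)"
        using Suc_times_binomial_eq[of k i] by (metis mult.commute of_nat_mult)
      then show ?thesis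
        by (simp add: Suc)
    qed simp
    have "A (Suc p) (Suc k) =
        (\<Sum>j\<le>Suc k. (-1) ^ (Suc k - j) * real j ^ p * (real j * real (Suc k choose j)))"
      unfolding A_def by (intro sum.cong) (auto simp: mult_ac)
    also have "\<dots> = real (Suc k) * (A p (Suc k) -
        (\<Sum>j\<le>Suc k. (-1) ^ (Suc k - j) * real (k choose j) * real j ^ p))"
      unfolding choose A_def sum_subtractf[symmetric] sum_distrib_left
      by (intro sum.cong refl) (simp add: algebra_simps del: of_nat_Suc binomial_Suc_Suc)
    also have "(\<Sum>j\<le>Suc k. (-1) ^ (Suc k - j) * real (k choose j) * real j ^ p) = - A p k"
      by (simp add: A_def Suc_diff_le sum_negf)
    finally show ?thesis
      by simp
  qed
  have "A p k = fact k * real (Stirling p k)"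
  proof (induction p arbitrary: k)
    case 0
    then show ?case
      by (cases k) (simp_all add: A_0)
  next
    case (Suc p)
    show ?case
    proof (cases k)
      case 0
      then show ?thesis
        by (simp add: A_def)
    next
      case (Suc i)
      then show ?thesis
        by (simp add: A_Suc Suc.IH) (simp add: algebra_simps)
    qed
  qed
  then show ?thesis
    by (simp add: A_def)
qed

end

theory Submission
  imports
    Defs
    "HOL-Complex_Analysis.Complex_Analysis"
    "HOL-Real_Asymp.Real_Asymp"
begin

text \<open>
  Necessity: by induction on the number of factors, peeling off one normal factor at a time. Each
  step is Gaussian integration by parts with \<open>\<integral>\<bar>x h(x)\<bar> \<le> \<sigma>\<^sup>2 \<integral>\<bar>h'(x)\<bar>\<close> whenever \<open>h(0) = 0\<close>; this bound makes
  Fubini's theorem applicable although only the last term of the chain is assumed to be integrable.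

  Sufficiency: on \<open>y\<^sub>+\<^sup>s\<close> with \<open>s > p\<close> the operator \<open>y\<^sup>-\<^sup>1 (y d/dy)\<^sup>p\<close> acts as \<open>s\<^sup>p y\<^sub>+\<^sup>s\<^sup>-\<^sup>1\<close>, so the
  Mellin transform \<open>m(x) = E W\<^sub>+\<^sup>x\<close> satisfies \<open>m(x + 2) = \<sigma>\<^sup>2 (x + 1)\<^sup>p m(x)\<close>. As \<open>m\<close> is logarithmically convex,
  the argument of Bohr and Mollerup determines it up to a factor, and by analytic continuation and
  uniqueness of characteristic functions the law of \<open>W\<close> on the positive half-line is a multiple of
  that of \<open>Y\<close>. The same holds on the negative half-line. The test functions \<open>1\<close> and \<open>y\<close> give
  \<open>E W = 0\<close> and \<open>E W\<^sup>2 = \<sigma>\<^sup>2\<close>, which forces both factors to be \<open>1\<close> and fixes the mass at \<open>0\<close>.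
\<close>

subsection \<open>Uniqueness of Laplace transforms\<close>

text \<open>Two obstacles shape the argument. The equation for \<open>W\<close> says only that a
  combination of terms is integrable, never that its single terms are; and truncated powers are
  admissible test functions only for s > p, so the functional equation of the Mellin transform is
  available only far to the right. The first obstacle is met by domination: in A y^(s-1) - y^(s+1)
  the second term outgrows the first, so cancellation cannot hide an infinite moment. The second is
  harmless, since a vertical strip in any position determines a measure after exponential tilting.
  With u = ln y a Mellin transform becomes a Laplace transform, which is why integrals of exp (x u)
  over measures on the whole line are studied first. The law of \<open>Y\<close> is treated as just
  another solution of the same equations, so its Mellin transform is never computed. The step 2 in
  the functional equation is the gap between the exponents s - 1 and s + 1 that the operator
  produces from y^s.\<close>

lemma norm_exp_diff_1_le: "norm (exp z - 1) \<le> norm z * exp (norm z)" for z :: complex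
proof -
  have "norm (exp z - exp 0) \<le> exp (norm z) * norm (z - 0)"
  proof (rule field_differentiable_bound[of "cball 0 (norm z)" exp exp])
    fix w :: complex assume w: "w \<in> cball 0 (norm z)"
    show "(exp has_field_derivative exp w) (at w within cball 0 (norm z))"
      by (rule DERIV_subset[OF DERIV_exp]) simp
    have "Re w \<le> norm z"
      using w complex_Re_le_cmod[of w] by (simp add: dist_norm)
    then show "norm (exp w) \<le> exp (norm z)"
      by simp
  qed auto
  then show ?thesis
    by (simp add: mult.commute)
qed

lemma exp_abs_le: "exp \<bar>x\<bar> \<le> exp x + exp (- x)" for x :: real
  by (cases "x \<ge> 0") auto

text \<open>Differentiation under the integral sign: near each point of the strip the difference
  quotients have one common integrable bound.\<close>

lemma holomorphic_laplace:
  fixes L :: "real measure"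
  assumes sets_L [measurable_cong]: "sets L = sets borel"
    and int: "\<And>x. a < x \<Longrightarrow> x < b \<Longrightarrow> integrable L (\<lambda>u. exp (x * u))"
  shows "(\<lambda>z. \<integral>u. exp (z * complex_of_real u) \<partial>L) holomorphic_on {z. a < Re z \<and> Re z < b}"
    (is "?F holomorphic_on ?S")
proof -
  have cint: "integrable L (\<lambda>u. exp (z * complex_of_real u))" if "a < Re z" "Re z < b" for z
    by (rule Bochner_Integration.integrable_bound[OF int[OF that]]) auto
  have "(?F has_field_derivative (\<integral>u. of_real u * exp (z * complex_of_real u) \<partial>L)) (at z)"
    if z: "z \<in> ?S" for z
  proof -
    \<comment> \<open>Dividing by 3 keeps Re z - 2 \<delta> and Re z + 2 \<delta> strictly inside
      the strip. One \<delta> pays for the perturbation \<open>norm h < \<delta>\<close>, the other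
      for the factor |u| <= exp (\<delta> |u|) / \<delta>; the sum of two exponentials in
      \<open>w\<close> replaces exp (2 \<delta> |u|).\<close>
    define \<delta> where "\<delta> = min (Re z - a) (b - Re z) / 3"
    have \<delta>: "\<delta> > 0" "a < Re z - 2 * \<delta>" "Re z + 2 * \<delta> < b"
      using z by (auto simp: \<delta>_def min_def field_simps)
    define w where "w u = (exp ((Re z + 2 * \<delta>) * u) + exp ((Re z - 2 * \<delta>) * u)) / \<delta>" for u
    have w_int: "integrable L w"
      unfolding w_def using \<delta> by (intro integrable_divide Bochner_Integration.integrable_add int) auto
    have dom: "norm ((exp ((z + h) * of_real u) - exp (z * of_real u)) / h) \<le> w u"
      if h: "h \<noteq> 0" "norm h < \<delta>" for h :: complex and u :: real
    proof -
      have "exp ((z + h) * of_real u) - exp (z * of_real u) = exp (z * of_real u) * (exp (h * of_real u) - 1)"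
        by (simp add: algebra_simps exp_add)
      then have "norm ((exp ((z + h) * of_real u) - exp (z * of_real u)) / h) =
          exp (Re z * u) * norm (exp (h * of_real u) - 1) / norm h"
        by (simp add: norm_divide norm_mult)
      also have "\<dots> \<le> exp (Re z * u) * (norm (h * of_real u) * exp (norm (h * of_real u))) / norm h"
        by (intro divide_right_mono mult_left_mono norm_exp_diff_1_le) auto
      also have "\<dots> = exp (Re z * u) * (\<bar>u\<bar> * exp (norm h * \<bar>u\<bar>))"
        using h by (simp add: norm_mult)
      also have "\<dots> \<le> exp (Re z * u) * ((exp (\<delta> * \<bar>u\<bar>) / \<delta>) * exp (\<delta> * \<bar>u\<bar>))"
      proof (intro mult_left_mono mult_mono)
        have "\<delta> * \<bar>u\<bar> \<le> exp (\<delta> * \<bar>u\<bar>)"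
          using exp_ge_add_one_self[of "\<delta> * \<bar>u\<bar>"] by linarith
        then show "\<bar>u\<bar> \<le> exp (\<delta> * \<bar>u\<bar>) / \<delta>"
          using \<delta> by (simp add: field_simps)
        show "exp (norm h * \<bar>u\<bar>) \<le> exp (\<delta> * \<bar>u\<bar>)"
          using h by (simp add: mult_right_mono)
      qed (use \<delta> in auto)
      also have "\<dots> = exp (Re z * u) * exp \<bar>2 * \<delta> * u\<bar> / \<delta>"
        using \<delta> by (simp add: exp_add[symmetric] abs_mult)
      also have "\<dots> \<le> exp (Re z * u) * (exp (2 * \<delta> * u) + exp (- (2 * \<delta> * u))) / \<delta>"
        using \<delta> by (intro divide_right_mono mult_left_mono exp_abs_le) auto
      also have "\<dots> = w u"
        by (simp add: w_def algebra_simps exp_add[symmetric] add_divide_distrib)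
      finally show ?thesis .
    qed
    \<comment> \<open>Dominated convergence speaks of sequences, so the limit is tested along an
      arbitrary sequence \<open>H\<close>; staying in the ball keeps every term below
      \<open>w\<close>.\<close>
    have "((\<lambda>h. (?F (z + h) - ?F z) / h) \<longlongrightarrow> (\<integral>u. of_real u * exp (z * complex_of_real u) \<partial>L))
        (at 0 within ball 0 \<delta>)"
      unfolding tendsto_at_iff_sequentially
    proof (intro allI impI)
      fix H :: "nat \<Rightarrow> complex"
      assume H: "\<forall>i. H i \<in> ball 0 \<delta> - {0}" "H \<longlonglongrightarrow> 0"
      have Hb: "a < Re (z + H i) \<and> Re (z + H i) < b" for i
        using H(1) \<delta> abs_Re_le_cmod[of "H i"] by (auto simp: dist_norm dest!: spec[of _ i])
      have "(\<lambda>i. \<integral>u. (exp ((z + H i) * of_real u) - exp (z * of_real u)) / H i \<partial>L)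
          \<longlonglongrightarrow> (\<integral>u. of_real u * exp (z * complex_of_real u) \<partial>L)"
      proof (rule integral_dominated_convergence[where w = w])
        show "AE u in L. (\<lambda>i. (exp ((z + H i) * of_real u) - exp (z * of_real u)) / H i)
            \<longlonglongrightarrow> of_real u * exp (z * of_real u)"
        proof (rule AE_I2)
          fix u
          have "((\<lambda>z. exp (z * complex_of_real u)) has_field_derivative of_real u * exp (z * of_real u)) (at z)"
            by (auto intro!: derivative_eq_intros)
          then have "((\<lambda>h. (exp ((z + h) * of_real u) - exp (z * of_real u)) / h) \<longlongrightarrow>
              of_real u * exp (z * of_real u)) (at 0)"
            by (simp add: DERIV_def)
          then show "(\<lambda>i. (exp ((z + H i) * of_real u) - exp (z * of_real u)) / H i)
            \<longlonglongrightarrow> of_real u * exp (z * of_real u)"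
            using H unfolding tendsto_at_iff_sequentially comp_def by auto
        qed
        show "AE u in L. norm ((exp ((z + H i) * of_real u) - exp (z * of_real u)) / H i) \<le> w u" for i
          using H(1) dom[of "H i"] by (auto simp: dist_norm)
      qed (use w_int in auto)
      moreover have "(\<integral>u. (exp ((z + H i) * of_real u) - exp (z * of_real u)) / H i \<partial>L) =
          (?F (z + H i) - ?F z) / H i" for i
      proof -
        have "(?F (z + H i) - ?F z) / H i = (\<integral>u. exp ((z + H i) * of_real u) - exp (z * of_real u) \<partial>L) / H i"
          using Hb[of i] z by (subst Bochner_Integration.integral_diff) (auto intro!: cint)
        then show ?thesis
          by (simp only: integral_divide_zero)
      qed
      ultimately show "((\<lambda>h. (?F (z + h) - ?F z) / h) \<circ> H) \<longlonglongrightarrow>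
          (\<integral>u. of_real u * exp (z * complex_of_real u) \<partial>L)"
        by (simp only: comp_def)
    qed
    then show ?thesis
      using \<delta> by (simp add: DERIV_def at_within_open[of 0 "ball 0 \<delta>"])
  qed
  moreover have "open ?S"
    by (simp add: open_Collect_conj open_halfspace_Re_gt open_halfspace_Re_lt)
  ultimately show ?thesis
    by (auto simp: holomorphic_on_open)
qed

text \<open>The integrand is strictly positive, so a vanishing integral at a single \<open>x\<close>
  leaves no mass anywhere.\<close>

lemma laplace_transform_zero:
  fixes L :: "real measure"
  assumes sets_L [measurable_cong]: "sets L = sets borel"
    and int: "integrable L (\<lambda>u. exp (x * u))" and zero: "(\<integral>u. exp (x * u) \<partial>L) = 0"
  shows "L = null_measure borel"
proof -
  have "AE u in L. exp (x * u) = 0"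
    using integral_nonneg_eq_0_iff_AE[OF int] zero by simp
  then have "emeasure L (space L) = 0"
    using AE_iff_null_sets[of "space L" L] by (auto simp: null_sets_def)
  then have "emeasure L A = 0" if "A \<in> sets L" for A
    using that emeasure_eq_0[of "space L" L A] by (auto dest: sets.sets_into_space)
  then show ?thesis
    by (intro measure_eqI) (auto simp: sets_L)
qed

text \<open>Agreement on a real interval spreads to the strip by the identity theorem. On one
  vertical line of the strip the transform is, up to a constant, the characteristic function of an
  exponentially tilted measure, so Levy's uniqueness theorem applies.\<close>

lemma laplace_transform_unique:
  fixes K L :: "real measure"
  assumes sets_K [measurable_cong]: "sets K = sets borel"
    and sets_L [measurable_cong]: "sets L = sets borel"
    and ab: "a < b"
    and intK: "\<And>x. a < x \<Longrightarrow> x < b \<Longrightarrow> integrable K (\<lambda>u. exp (x * u))"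
    and intL: "\<And>x. a < x \<Longrightarrow> x < b \<Longrightarrow> integrable L (\<lambda>u. exp (x * u))"
    and eq: "\<And>x. a < x \<Longrightarrow> x < b \<Longrightarrow> (\<integral>u. exp (x * u) \<partial>K) = (\<integral>u. exp (x * u) \<partial>L)"
  shows "K = L"
proof -
  let ?S = "{z. a < Re z \<and> Re z < b}"
  define F where "F Q z = (\<integral>u. exp (z * complex_of_real u) \<partial>Q)" for Q :: "real measure" and z
  define x where "x = (a + b) / 2"
  have x: "a < x" "x < b"
    using ab by (auto simp: x_def)
  have FF: "F K z = F L z" if z: "z \<in> ?S" for z
  proof -
    have hol: "(\<lambda>z. F K z - F L z) holomorphic_on ?S"
      unfolding F_def
      by (intro holomorphic_intros holomorphic_laplace sets_K sets_L intK intL)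
    have conv: "convex ?S"
    proof -
      have "?S = {z. Re z > a} \<inter> {z. Re z < b}"
        by auto
      then show ?thesis
        by (metis convex_Int convex_halfspace_Re_gt convex_halfspace_Re_lt)
    qed
    have lim: "complex_of_real x islimpt complex_of_real ` {a<..<b}"
      using x by (intro islimpt_isCont_image) (auto simp: eventually_at_filter)
    have "F K z - F L z = 0"
    proof (rule analytic_continuation[OF hol _ _ _ _ lim])
      show "open ?S"
        by (simp add: open_Collect_conj open_halfspace_Re_gt open_halfspace_Re_lt)
      fix w assume "w \<in> complex_of_real ` {a<..<b}"
      then obtain y where y: "a < y" "y < b" "w = of_real y"
        by auto
      have "F Q w = of_real (\<integral>u. exp (y * u) \<partial>Q)" for Q
        unfolding F_def y(3) integral_complex_of_real[symmetric]
        by (simp flip: exp_of_real)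
      then show "F K w - F L w = 0"
        using eq[OF y(1,2)] by simp
    qed (use conv x z in \<open>auto intro: convex_connected\<close>)
    then show ?thesis
      by simp
  qed
  define m where "m = (\<integral>u. exp (x * u) \<partial>L)"
  have mK: "m = (\<integral>u. exp (x * u) \<partial>K)"
    using eq[OF x] by (simp add: m_def)
  have m0: "m \<ge> 0"
    unfolding m_def by simp
  show ?thesis
  \<comment> \<open>The tilt is normalised by \<open>m\<close>; when \<open>m = 0\<close> both
    measures are null.\<close>
  proof (cases "m = 0")
    case True
    show ?thesis
      using True mK m_def laplace_transform_zero[OF sets_K intK[OF x]] laplace_transform_zero[OF sets_L intL[OF x]]
      by simp
  next
    case False
    then have m: "m > 0"
      using m0 by simp
    \<comment> \<open>The exponential tilt at the abscissa \<open>x\<close>. It turns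
      \<open>Q\<close>, which need not be finite, into a probability measure, and its density is
      strictly positive, so that \<open>Q\<close> can be recovered from it.\<close>
    define P where "P Q = density Q (\<lambda>u. ennreal (exp (x * u) / m))" for Q :: "real measure"
    have P: "real_distribution (P Q)" "\<And>t. char (P Q) t = F Q (Complex x t) / m"
        "Q = density (P Q) (\<lambda>u. ennreal (m * exp (- (x * u))))"
      if Q [measurable_cong]: "sets Q = sets borel" and Qi: "integrable Q (\<lambda>u. exp (x * u))"
        "(\<integral>u. exp (x * u) \<partial>Q) = m" for Q
    proof -
      have "emeasure (P Q) (space (P Q)) = (\<integral>\<^sup>+u. ennreal (exp (x * u) / m) \<partial>Q)"
        by (simp add: P_def emeasure_density cong: nn_integral_cong)
      also have "\<dots> = ennreal (\<integral>u. exp (x * u) / m \<partial>Q)"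
        using Qi m by (intro nn_integral_eq_integral) auto
      also have "\<dots> = 1"
        using Qi m by simp
      finally have "prob_space (P Q)"
        by (intro prob_spaceI)
      then show "real_distribution (P Q)"
        by (auto simp: real_distribution_def real_distribution_axioms_def P_def Q)
      show "char (P Q) t = F Q (Complex x t) / m" for t
      proof -
        have "char (P Q) t = (\<integral>u. (exp (x * u) / m) *\<^sub>R iexp (t * u) \<partial>Q)"
          unfolding char_def P_def using m by (subst integral_density) auto
        also have "\<dots> = (\<integral>u. exp (Complex x t * complex_of_real u) / m \<partial>Q)"
          by (intro Bochner_Integration.integral_cong refl)
             (simp add: scaleR_conv_of_real exp_of_real[symmetric] exp_add[symmetric] complex_eq algebra_simps Complex_eq)
        finally show ?thesis
          by (simp add: F_def)
      qed
      show "Q = density (P Q) (\<lambda>u. ennreal (m * exp (- (x * u))))"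
      proof -
        have "ennreal (exp (x * u) / m) * ennreal (m * exp (- (x * u))) = 1" for u
          using m by (simp add: ennreal_mult[symmetric] exp_minus)
        then show ?thesis
          by (simp add: P_def density_density_eq density_1)
      qed
    qed
    note PK = P[OF sets_K intK[OF x] mK[symmetric]]
    note PL = P[OF sets_L intL[OF x] m_def[symmetric]]
    have "P K = P L"
    proof (rule Levy_uniqueness[OF PK(1) PL(1)])
      show "char (P K) = char (P L)"
        using FF[of "Complex x t" for t] x by (intro ext) (simp add: PK(2) PL(2))
    qed
    then show ?thesis
      using PK(3) PL(3) by simp
  qed
qed

section \<open>Convex solutions of difference equations and logarithmic convexity\<close>

text \<open>The additive form of the Bohr-Mollerup argument. Convexity confines the increment of any
  solution over [z, z + t] between the increments over two adjacent steps of length c, scaled by t /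
  c, and these are values of \<open>g\<close>. Since f - h is c-periodic, its variation can be
  estimated arbitrarily far to the right, where the two bounds merge.\<close>

lemma convex_difference_equation_unique:
  fixes f h g :: "real \<Rightarrow> real"
  assumes convf: "convex_on {a<..} f" and convh: "convex_on {a<..} h" and c: "c > 0"
    and f: "\<And>x. a < x \<Longrightarrow> f (x + c) - f x = g x"
    and h: "\<And>x. a < x \<Longrightarrow> h (x + c) - h x = g x"
    and g: "((\<lambda>x. g (x + c) - g x) \<longlongrightarrow> 0) at_top"
    and x: "a < x" and y: "a < y"
  shows "f x - h x = f y - h y"
proof -
  have nc: "0 \<le> real n * c" for n
    using c by simp
  have shift: "f (x + real n * c) - h (x + real n * c) = f x - h x" if "a < x" for x n
  proof (induction n)
    case (Suc n)
    have "a < x + real n * c"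
      using that nc[of n] by linarith
    from f[OF this] h[OF this] Suc show ?case
      by (simp add: algebra_simps)
  qed simp
  \<comment> \<open>Upper bound: z + t lies on the chord interval from z to z + c, with weight t /
    c. Lower bound: z lies between z - c and z + t, with weight c / (c + t).\<close>
  have slope: "t / c * g (z - c) \<le> F (z + t) - F z" "F (z + t) - F z \<le> t / c * g z"
    if F: "convex_on {a<..} F" "\<And>x. a < x \<Longrightarrow> F (x + c) - F x = g x"
      and z: "a < z - c" and t: "0 \<le> t" "t \<le> c" for F z t
  proof -
    have "F ((1 - t / c) *\<^sub>R z + (t / c) *\<^sub>R (z + c)) \<le> (1 - t / c) * F z + t / c * F (z + c)"
      using z t c by (intro convex_onD[OF F(1)]) (auto simp: divide_simps)
    moreover have "(1 - t / c) *\<^sub>R z + (t / c) *\<^sub>R (z + c) = z + t"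
      using c by (simp add: field_simps)
    moreover have "F (z + c) = F z + g z"
      using F(2)[of z] z c by simp
    moreover have "(1 - t / c) * F z + t / c * (F z + g z) = F z + t / c * g z"
      by (simp add: algebra_simps add_divide_distrib)
    ultimately show "F (z + t) - F z \<le> t / c * g z"
      by simp
    have "F ((1 - c / (c + t)) *\<^sub>R (z - c) + (c / (c + t)) *\<^sub>R (z + t)) \<le>
        (1 - c / (c + t)) * F (z - c) + c / (c + t) * F (z + t)"
      using z t c by (intro convex_onD[OF F(1)]) (auto simp: divide_simps)
    also have "(1 - c / (c + t)) *\<^sub>R (z - c) + (c / (c + t)) *\<^sub>R (z + t) = z - c + c / (c + t) * (c + t)"
      by (simp only: real_scaleR_def) (simp only: algebra_simps)
    also have "z - c + c / (c + t) * (c + t) = z"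
      using c t by simp
    also have "1 - c / (c + t) = t / (c + t)"
      using c t by (simp add: field_simps)
    also have "t / (c + t) * F (z - c) + c / (c + t) * F (z + t) = (t * F (z - c) + c * F (z + t)) / (c + t)"
      by (simp add: add_divide_distrib)
    finally have "(c + t) * F z \<le> t * F (z - c) + c * F (z + t)"
      using c t by (simp add: pos_le_divide_eq mult.commute)
    moreover have "F z = F (z - c) + g (z - c)"
      using F(2)[OF z] by simp
    ultimately show "t / c * g (z - c) \<le> F (z + t) - F z"
      using c by (simp add: field_simps)
  qed
  have near: "f y - h y = f x - h x" if x: "a < x" "x \<le> y" "y \<le> x + c" for x y
  proof -
    have bound: "\<bar>(f y - h y) - (f x - h x)\<bar> \<le>
        (y - x) / c * (g (x + real n * c + c) - g (x + real n * c))" for n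
    proof -
      \<comment> \<open>\<open>Suc n\<close> instead of \<open>n\<close>, because the lower bound
        looks back to z - c, which must still exceed \<open>a\<close>.\<close>
      define z where "z = x + real (Suc n) * c"
      have z: "a < z - c"
      proof -
        have "a < x + real n * c"
          using x nc[of n] by linarith
        then show ?thesis
          by (simp add: z_def algebra_simps)
      qed
      have eq: "f x - h x = f z - h z" "f y - h y = f (z + (y - x)) - h (z + (y - x))"
        using shift[of x "Suc n"] shift[of y "Suc n"] x by (simp_all add: z_def algebra_simps)
      show ?thesis
        using slope[OF convf f z, of "y - x"] slope[OF convh h z, of "y - x"] x
        unfolding eq by (simp add: z_def algebra_simps abs_le_iff)
    qed
    have "filterlim (\<lambda>n. x + real n * c) at_top sequentially"
      using c by real_asymp
    from tendsto_mult_left[OF filterlim_compose[OF g this], of "(y - x) / c"]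
    have "(\<lambda>n. (y - x) / c * (g (x + real n * c + c) - g (x + real n * c))) \<longlonglongrightarrow> 0"
      by simp
    from LIMSEQ_le_const[OF this] bound have "\<bar>(f y - h y) - (f x - h x)\<bar> \<le> 0"
      by blast
    then show ?thesis
      by simp
  qed
  have main: "f y - h y = f x - h x" if x: "a < x" "x \<le> y" for x y
  proof -
    \<comment> \<open>The number of whole steps of length c between x and y; periodicity removes
      them and leaves a distance of at most c.\<close>
    define n where "n = nat \<lfloor>(y - x) / c\<rfloor>"
    have "real n = of_int \<lfloor>(y - x) / c\<rfloor>"
      using x c by (simp add: n_def)
    then have "real n \<le> (y - x) / c" "(y - x) / c < real n + 1"
      by linarith+
    then have "x + real n * c \<le> y" "y \<le> x + real n * c + c"
      using c by (simp_all add: field_simps)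
    moreover have "a < x + real n * c"
      using x nc[of n] by linarith
    ultimately show ?thesis
      using near[of "x + real n * c" y] shift[OF x(1), of n] by simp
  qed
  show ?thesis
    using main[of x y] main[of y x] x y by (cases "x \<le> y") auto
qed

lemma laplace_transform_pos:
  fixes L :: "real measure"
  assumes "sets L = sets borel" "integrable L (\<lambda>u. exp (x * u))" "L \<noteq> null_measure borel"
  shows "0 < (\<integral>u. exp (x * u) \<partial>L)"
proof -
  have "0 \<le> (\<integral>u. exp (x * u) \<partial>L)"
    by simp
  then show ?thesis
    using laplace_transform_zero[OF assms(1,2)] assms(3) by linarith
qed

text \<open>This is Hoelder's inequality. It comes from the convexity of exp once exp (x u) and exp
  (y u) are scaled to have integral one.\<close>

lemma convex_ln_laplace_transform:
  fixes L :: "real measure"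
  assumes sets_L: "sets L = sets borel" and L0: "L \<noteq> null_measure borel"
    and int: "\<And>x. a < x \<Longrightarrow> integrable L (\<lambda>u. exp (x * u))"
  shows "convex_on {a<..} (\<lambda>x. ln (\<integral>u. exp (x * u) \<partial>L))"
proof (intro convex_onI)
  fix t x y :: real
  assume t: "0 < t" "t < 1" and xy: "x \<in> {a<..}" "y \<in> {a<..}"
  define M where "M x = (\<integral>u. exp (x * u) \<partial>L)" for x
  define z where "z = (1 - t) *\<^sub>R x + t *\<^sub>R y"
  have z: "a < z"
    using convexD_alt[of "{a<..}" x y t] xy t by (simp add: z_def algebra_simps)
  have pos: "M x > 0" "M y > 0" "M z > 0"
    using xy z laplace_transform_pos[OF sets_L int L0] by (auto simp only: M_def greaterThan_iff)
  \<comment> \<open>The desired bound, the weighted geometric mean of M x and M y. Pulling it out of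
    exp (z u) leaves a quantity dominated by a convex combination of two functions of integral
    one.\<close>
  define R where "R = exp ((1 - t) * ln (M x) + t * ln (M y))"
  have "M z \<le> (\<integral>u. R * ((1 - t) * (exp (x * u) / M x) + t * (exp (y * u) / M y)) \<partial>L)"
    unfolding M_def
  proof (rule integral_mono)
    fix u
    have "exp (z * u) = R * exp ((1 - t) *\<^sub>R (x * u - ln (M x)) + t *\<^sub>R (y * u - ln (M y)))"
      by (simp add: R_def z_def exp_add[symmetric] algebra_simps)
    also have "\<dots> \<le> R * ((1 - t) * exp (x * u - ln (M x)) + t * exp (y * u - ln (M y)))"
      using t by (intro mult_left_mono convex_onD[OF exp_convex]) (auto simp: R_def)
    also have "\<dots> = R * ((1 - t) * (exp (x * u) / M x) + t * (exp (y * u) / M y))"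
      using pos by (simp add: exp_diff)
    finally show "exp (z * u) \<le> R * ((1 - t) * (exp (x * u) / (\<integral>u. exp (x * u) \<partial>L)) +
        t * (exp (y * u) / (\<integral>u. exp (y * u) \<partial>L)))"
      by (simp add: M_def)
  qed (use int z xy in auto)
  also have "\<dots> = R * ((1 - t) * (M x / M x) + t * (M y / M y))"
    using int xy by (simp add: M_def)
  also have "\<dots> = R"
    using pos by simp
  finally have "ln (M z) \<le> ln R"
    using pos by simp
  then show "ln (M z) \<le> (1 - t) * ln (M x) + t * ln (M y)"
    by (simp add: R_def)
qed auto

text \<open>
  The Bohr-Mollerup argument: a Laplace transform is logarithmically convex, so a functional
  equation of the type of the Gamma function determines it up to a factor.
\<close>

lemma laplace_transform_functional_equation:
  fixes K L :: "real measure" and r :: "real \<Rightarrow> real"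
  assumes sets: "sets K = sets borel" "sets L = sets borel" and L0: "L \<noteq> null_measure borel"
    and int: "\<And>x. a < x \<Longrightarrow> integrable K (\<lambda>u. exp (x * u))"
      "\<And>x. a < x \<Longrightarrow> integrable L (\<lambda>u. exp (x * u))"
    and c: "c > 0" and r: "\<And>x. a < x \<Longrightarrow> r x > 0"
      "((\<lambda>x. ln (r (x + c)) - ln (r x)) \<longlongrightarrow> 0) at_top"
    and eq: "\<And>x. a < x \<Longrightarrow> (\<integral>u. exp ((x + c) * u) \<partial>K) = r x * (\<integral>u. exp (x * u) \<partial>K)"
      "\<And>x. a < x \<Longrightarrow> (\<integral>u. exp ((x + c) * u) \<partial>L) = r x * (\<integral>u. exp (x * u) \<partial>L)"
  shows "\<exists>d\<ge>0. K = density L (\<lambda>_. ennreal d)"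
proof (cases "K = null_measure borel")
  \<comment> \<open>Logarithms need positive transforms, so the null measure is set apart; it is the
    multiple of \<open>L\<close> with d = 0.\<close>
  case True
  have "null_measure borel = density L (\<lambda>_. ennreal 0)"
    by (rule measure_eqI) (auto simp: sets emeasure_density)
  then show ?thesis
    using True by blast
next
  case False
  define FK where "FK x = (\<integral>u. exp (x * u) \<partial>K)" for x
  define FL where "FL x = (\<integral>u. exp (x * u) \<partial>L)" for x
  have pos: "FK x > 0" "FL x > 0" if "a < x" for x
    using laplace_transform_pos[OF sets(1) int(1)[OF that] False]
      laplace_transform_pos[OF sets(2) int(2)[OF that] L0] by (auto simp: FK_def FL_def)
  have diff: "ln (FK x) - ln (FL x) = ln (FK (a + 1)) - ln (FL (a + 1))" if x: "a < x" for x
  proof (rule convex_difference_equation_unique[where a = a and c = c and g = "\<lambda>x. ln (r x)"])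
    show "convex_on {a<..} (\<lambda>x. ln (FK x))" "convex_on {a<..} (\<lambda>x. ln (FL x))"
      unfolding FK_def FL_def
      by (intro convex_ln_laplace_transform sets int False L0; assumption)+
    show "ln (FK (x + c)) - ln (FK x) = ln (r x)" "ln (FL (x + c)) - ln (FL x) = ln (r x)"
      if "a < x" for x
      using eq[OF that] pos[OF that] r(1)[OF that] by (simp_all add: FK_def FL_def ln_mult)
  qed (use c r x in auto)
  define d where "d = FK (a + 1) / FL (a + 1)"
  have d: "d > 0"
    using pos[of "a + 1"] by (simp add: d_def)
  have scaled: "FK x = d * FL x" if "a < x" for x
  proof -
    have "ln (FK x) = ln (d * FL x)"
      using diff[OF that] pos[OF that] pos[of "a + 1"] d by (simp add: d_def ln_mult ln_div)
    then show ?thesis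
      using pos[OF that] d by simp
  qed
  have "K = density L (\<lambda>_. ennreal d)"
  proof (rule laplace_transform_unique[of _ _ a "a + 1"])
    show "integrable (density L (\<lambda>_. ennreal d)) (\<lambda>u. exp (x * u))" if "a < x" for x
      using d sets int(2)[OF that] by (subst integrable_density) auto
    show "(\<integral>u. exp (x * u) \<partial>K) = (\<integral>u. exp (x * u) \<partial>density L (\<lambda>_. ennreal d))" if "a < x" for x
      using d sets scaled[OF that] by (subst integral_density) (auto simp: FK_def FL_def)
  qed (use sets int in auto)
  then show ?thesis
    using d by (intro exI[of _ d]) simp
qed

subsection \<open>Truncated powers and the law on the positive half-line\<close>

text \<open>The value at 0 is 0 for every exponent, s = 0 included, so an atom of a law at the
  origin never contributes to the integrals.\<close>

definition pos_powr :: "real \<Rightarrow> real \<Rightarrow> real" where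
  "pos_powr s y = (if y > 0 then y powr s else 0)"

lemma borel_measurable_pos_powr [measurable]: "pos_powr s \<in> borel_measurable borel"
  unfolding pos_powr_def [abs_def] by measurable

lemma pos_powr_nonneg: "0 \<le> pos_powr s y"
  by (simp add: pos_powr_def)

lemma pos_powr_mono_exponent: "0 \<le> r \<Longrightarrow> r \<le> s \<Longrightarrow> pos_powr r y \<le> 1 + pos_powr s y"
proof (cases "y \<ge> 1")
  case True
  then show "r \<le> s \<Longrightarrow> pos_powr r y \<le> 1 + pos_powr s y"
    using powr_mono[of r s y] by (simp add: pos_powr_def)
next
  case False
  assume "0 \<le> r"
  then have "pos_powr r y \<le> 1"
    using False powr_mono2[of r y 1] by (auto simp: pos_powr_def)
  then show "pos_powr r y \<le> 1 + pos_powr s y"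
    using pos_powr_nonneg[of s y] by linarith
qed

text \<open>Recovers single moments from the integrability of a difference. For y >= sqrt (2 A) the
  term y^(s+1) is at least twice A y^(s-1), hence at most twice the absolute difference; below that
  threshold it is bounded.\<close>

lemma integrable_pos_powr:
  fixes Q :: "real measure"
  assumes "prob_space Q" and sets_Q [measurable_cong]: "sets Q = sets borel" and A: "A > 0" and s: "s \<ge> 1"
    and int: "integrable Q (\<lambda>y. A * pos_powr (s - 1) y - pos_powr (s + 1) y)"
    and r: "0 \<le> r" "r \<le> s + 1"
  shows "integrable Q (pos_powr r)"
proof -
  interpret prob_space Q by fact
  define B where "B = sqrt (2 * A)"
  have B: "B > 0" "B\<^sup>2 = 2 * A"
    using A by (auto simp: B_def)
  have bound: "pos_powr (s + 1) y \<le> 2 * \<bar>A * pos_powr (s - 1) y - pos_powr (s + 1) y\<bar> + B powr (s + 1)" for y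
  proof (cases "y \<ge> B")
    case True
    then have y: "y > 0"
      using B by linarith
    have "pos_powr (s + 1) y = y powr 2 * y powr (s - 1)"
      using y powr_add[of y 2 "s - 1"] by (simp add: pos_powr_def algebra_simps)
    moreover have "2 * A \<le> y powr 2"
      using True B y power_mono[OF True, of 2] by (simp add: powr_numeral)
    ultimately have "2 * A * pos_powr (s - 1) y \<le> pos_powr (s + 1) y"
      using y by (simp add: pos_powr_def mult_right_mono)
    moreover have "a \<le> 2 * \<bar>b - a\<bar> + c" if "2 * b \<le> a" "c \<ge> 0" for a b c :: real
      using that by argo
    ultimately show ?thesis
      by (simp add: mult.assoc)
  next
    case False
    then have "pos_powr (s + 1) y \<le> B powr (s + 1)"
      using s powr_mono2[of "s + 1" y B] by (auto simp: pos_powr_def)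
    then show ?thesis
      by (intro add_increasing) auto
  qed
  have "integrable Q (\<lambda>y. 2 * \<bar>A * pos_powr (s - 1) y - pos_powr (s + 1) y\<bar> + B powr (s + 1) + 1)"
    using int by auto
  then show ?thesis
  proof (rule Bochner_Integration.integrable_bound)
    show "AE y in Q. norm (pos_powr r y) \<le>
        norm (2 * \<bar>A * pos_powr (s - 1) y - pos_powr (s + 1) y\<bar> + B powr (s + 1) + 1)"
    proof (rule AE_I2)
      fix y
      show "norm (pos_powr r y) \<le>
        norm (2 * \<bar>A * pos_powr (s - 1) y - pos_powr (s + 1) y\<bar> + B powr (s + 1) + 1)"
        using bound[of y] pos_powr_mono_exponent[OF r, of y] pos_powr_nonneg[of r y] by simp
    qed
  qed simp
qed

text \<open>With x = s - 1 the equation reads m(x + 2) = s2 (x + 1)^p m(x) for both laws, and u = ln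
  y makes it a statement on Laplace transforms. The conclusion is phrased with nonnegative integrals
  so that moments and indicators are covered at once, without any integrability.\<close>

lemma positive_half_proportional:
  fixes \<mu> \<nu> :: "real measure"
  assumes prob: "prob_space \<mu>" "prob_space \<nu>"
    and sets: "sets \<mu> = sets borel" "sets \<nu> = sets borel" and s2: "s2 > 0"
    and eq: "\<And>Q s. Q \<in> {\<mu>, \<nu>} \<Longrightarrow> s > real p \<Longrightarrow> s > 1 \<Longrightarrow>
        integrable Q (\<lambda>y. s2 * s ^ p * pos_powr (s - 1) y - pos_powr (s + 1) y) \<and>
        (\<integral>y. s2 * s ^ p * pos_powr (s - 1) y - pos_powr (s + 1) y \<partial>Q) = 0"
    and pos: "emeasure \<nu> {0<..} \<noteq> 0"
  shows "\<exists>d. \<forall>g :: real \<Rightarrow> ennreal. g \<in> borel_measurable borel \<longrightarrow>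
      (\<integral>\<^sup>+y. g y * indicator {0<..} y \<partial>\<mu>) = ennreal d * (\<integral>\<^sup>+y. g y * indicator {0<..} y \<partial>\<nu>)"
proof -
  \<comment> \<open>The restriction of \<open>Q\<close> to the open positive half-line, pushed
    forward by \<open>ln\<close>; its Laplace transform is the Mellin transform of that part of
    \<open>Q\<close>.\<close>
  define L where "L Q = distr (density Q (\<lambda>y. ennreal (indicator {0<..} y))) borel ln" for Q :: "real measure"
  have sets_L: "sets (L Q) = sets borel" for Q
    by (simp add: L_def)
  have nn: "(\<integral>\<^sup>+u. h u \<partial>L Q) = (\<integral>\<^sup>+y. h (ln y) * indicator {0<..} y \<partial>Q)"
    if [measurable_cong]: "sets Q = sets borel" and [measurable]: "h \<in> borel_measurable borel" for h :: "real \<Rightarrow> ennreal" and Q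
    unfolding L_def
    by (simp add: nn_integral_distr nn_integral_density mult.commute ennreal_indicator)
  have pp: "indicator {0<..} y * exp (x * ln y) = pos_powr x y" for x y
    by (auto simp: pos_powr_def powr_def)
  have L_int: "integrable (L Q) (\<lambda>u. exp (x * u)) \<longleftrightarrow> integrable Q (pos_powr x)"
    and L_eq: "(\<integral>u. exp (x * u) \<partial>L Q) = (\<integral>y. pos_powr x y \<partial>Q)"
    if [measurable_cong]: "sets Q = sets borel" for Q x
    by (simp_all add: L_def integrable_distr_eq integral_distr integrable_real_density integral_density
        integrable_density pp)
  have int: "integrable Q (pos_powr x)" if Q: "Q \<in> {\<mu>, \<nu>}" and x: "x > real p" for Q x
    using eq[OF Q, of "x + 1"] x s2 prob sets Q
    by (intro integrable_pos_powr[of Q "s2 * (x + 1) ^ p" "x + 1"]) auto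
  have shift: "(\<integral>y. pos_powr (x + 2) y \<partial>Q) = s2 * (x + 1) ^ p * (\<integral>y. pos_powr x y \<partial>Q)"
    if Q: "Q \<in> {\<mu>, \<nu>}" and x: "x > real p" for Q x
  proof -
    have "(\<integral>y. s2 * (x + 1) ^ p * pos_powr x y - pos_powr (x + 2) y \<partial>Q) = 0"
      using eq[OF Q, of "x + 1"] x by (simp add: add.commute)
    then show ?thesis
      using int[OF Q, of x] int[OF Q, of "x + 2"] x
      by (subst (asm) Bochner_Integration.integral_diff) auto
  qed
  have "\<exists>d\<ge>0. L \<mu> = density (L \<nu>) (\<lambda>_. ennreal d)"
  proof (rule laplace_transform_functional_equation[where a = "real p" and c = 2 and r = "\<lambda>x. s2 * (x + 1) ^ p"])
    have "emeasure (L \<nu>) UNIV = emeasure \<nu> {0<..}"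
      using nn[OF sets(2), of "\<lambda>_. 1"] sets by (simp add: sets_eq_imp_space_eq[OF sets_L])
    then show "L \<nu> \<noteq> null_measure borel"
      using pos by auto
    \<comment> \<open>The factor is polynomial in x, so the increments of its logarithm are p times
      those of ln (x + 1) and vanish at infinity.\<close>
    show "((\<lambda>x. ln (s2 * (x + 2 + 1) ^ p) - ln (s2 * (x + 1) ^ p)) \<longlongrightarrow> 0) at_top"
    proof -
      have "((\<lambda>x. real p * (ln (x + 2 + 1) - ln (x + 1))) \<longlongrightarrow> real p * 0) at_top"
        by (intro tendsto_mult_left) real_asymp
      moreover have "eventually (\<lambda>x. real p * (ln (x + 2 + 1) - ln (x + 1)) =
          ln (s2 * (x + 2 + 1) ^ p) - ln (s2 * (x + 1) ^ p)) at_top"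
        using eventually_gt_at_top[of 0]
        by eventually_elim (use s2 in \<open>simp add: ln_mult ln_realpow algebra_simps\<close>)
      ultimately show ?thesis
        by (simp add: filterlim_cong)
    qed
  qed (use sets s2 sets_L shift int in \<open>auto simp: L_int L_eq\<close>)
  then obtain d where d: "d \<ge> 0" "L \<mu> = density (L \<nu>) (\<lambda>_. ennreal d)"
    by blast
  show ?thesis
  proof (intro exI allI impI)
    fix g :: "real \<Rightarrow> ennreal" assume [measurable]: "g \<in> borel_measurable borel"
    have g: "(\<integral>\<^sup>+u. g (exp u) \<partial>L Q) = (\<integral>\<^sup>+y. g y * indicator {0<..} y \<partial>Q)" if "sets Q = sets borel" for Q
      by (subst nn[OF that]) (auto intro!: nn_integral_cong split: split_indicator)
    have "(\<integral>\<^sup>+u. g (exp u) \<partial>L \<mu>) = ennreal d * (\<integral>\<^sup>+u. g (exp u) \<partial>L \<nu>)"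
      unfolding d(2) by (simp add: nn_integral_density nn_integral_cmult measurable_cong_sets[OF sets_L refl])
    then show "(\<integral>\<^sup>+y. g y * indicator {0<..} y \<partial>\<mu>) = ennreal d * (\<integral>\<^sup>+y. g y * indicator {0<..} y \<partial>\<nu>)"
      using g sets by simp
  qed
qed

subsection \<open>Iterated derivatives and the Euler operator\<close>

lemma continuously_differentiable_has_derivative:
  assumes "continuously_differentiable n f" "t < n"
  shows "((deriv ^^ t) f has_real_derivative (deriv ^^ Suc t) f x) (at x)"
  using assms DERIV_deriv_iff_field_differentiable
  by (auto simp: continuously_differentiable_def)

lemma continuously_differentiable_continuous:
  assumes "continuously_differentiable n f" "t \<le> n"
  shows "continuous_on UNIV ((deriv ^^ t) f)"
proof (cases "t = n")
  case False
  then show ?thesis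
    using assms continuously_differentiable_has_derivative[of n f t]
    by (intro DERIV_continuous_on) auto
qed (use assms in \<open>simp add: continuously_differentiable_def\<close>)

lemma continuously_differentiable_measurable:
  assumes "continuously_differentiable n f" "t \<le> n"
  shows "(deriv ^^ t) f \<in> borel_measurable borel"
  by (rule borel_measurable_continuous_onI[OF continuously_differentiable_continuous[OF assms]])

lemma continuously_differentiable_mono:
  assumes "continuously_differentiable n f" "m \<le> n"
  shows "continuously_differentiable m f"
  using assms continuously_differentiable_continuous[OF assms]
  by (auto simp: continuously_differentiable_def)

text \<open>The explicit iterated derivatives below all come from here: naming the whole sequence
  \<open>h\<close> of candidates yields smoothness and the formulas together.\<close>

lemma iterated_derivI:
  assumes h0: "h 0 = f"
    and h: "\<And>t x. t < n \<Longrightarrow> (h t has_real_derivative h (Suc t) x) (at x)"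
    and cont: "continuous_on UNIV (h n)"
  shows continuously_differentiableI: "continuously_differentiable n f"
    and iterated_deriv_eqI: "t \<le> n \<Longrightarrow> (deriv ^^ t) f = h t"
proof -
  have eq: "(deriv ^^ t) f = h t" if "t \<le> n" for t
    using that
  proof (induction t)
    case (Suc t)
    then show ?case
      using h[of t] by (auto intro!: DERIV_imp_deriv)
  qed (simp add: h0)
  then show "t \<le> n \<Longrightarrow> (deriv ^^ t) f = h t"
    by simp
  show "continuously_differentiable n f"
    using eq cont h by (auto simp: continuously_differentiable_def field_differentiable_def)
qed

text \<open>Serves with r a frozen factor of a product, and with r = -1 for reflected truncated
  powers.\<close>

lemma dilation_derivatives:
  assumes f: "continuously_differentiable n f"
  shows continuously_differentiable_dilation: "continuously_differentiable n (\<lambda>y. f (r * y))"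
    and iterated_deriv_dilation:
      "t \<le> n \<Longrightarrow> (deriv ^^ t) (\<lambda>y. f (r * y)) = (\<lambda>y. r ^ t * (deriv ^^ t) f (r * y))"
proof -
  define h where "h = (\<lambda>t y. r ^ t * (deriv ^^ t) f (r * y))"
  have h0: "h 0 = (\<lambda>y. f (r * y))"
    by (simp add: h_def)
  have h: "(h t has_real_derivative h (Suc t) x) (at x)" if "t < n" for t x
    unfolding h_def
    by (rule derivative_eq_intros DERIV_chain2[OF continuously_differentiable_has_derivative[OF f that]] refl)+
       (simp add: mult_ac)
  have cont: "continuous_on UNIV (h n)"
    unfolding h_def
    by (intro continuous_intros continuous_on_compose2[OF continuously_differentiable_continuous[OF f]]) auto
  show "continuously_differentiable n (\<lambda>y. f (r * y))"
    by (rule continuously_differentiableI[OF h0 h cont])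
  show "t \<le> n \<Longrightarrow> (deriv ^^ t) (\<lambda>y. f (r * y)) = (\<lambda>y. r ^ t * (deriv ^^ t) f (r * y))"
    using iterated_deriv_eqI[OF h0 h cont] by (simp add: h_def)
qed

text \<open>Allows a test function to be shifted so that it vanishes at 0 without touching the
  derivative part of the operator.\<close>

lemma diff_const_derivatives:
  assumes f: "continuously_differentiable n f"
  shows continuously_differentiable_diff_const: "continuously_differentiable n (\<lambda>y. f y - c)"
    and iterated_deriv_diff_const:
      "0 < t \<Longrightarrow> t \<le> n \<Longrightarrow> (deriv ^^ t) (\<lambda>y. f y - c) = (deriv ^^ t) f"
proof -
  define h where "h = (\<lambda>t y. (deriv ^^ t) f y - (if t = 0 then c else 0))"
  have h0: "h 0 = (\<lambda>y. f y - c)"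
    by (simp add: h_def)
  have h: "(h t has_real_derivative h (Suc t) x) (at x)" if "t < n" for t x
    unfolding h_def
    by (rule derivative_eq_intros continuously_differentiable_has_derivative[OF f that] refl)+ simp
  have cont: "continuous_on UNIV (h n)"
    unfolding h_def
    by (intro continuous_intros continuously_differentiable_continuous[OF f]) auto
  show "continuously_differentiable n (\<lambda>y. f y - c)"
    by (rule continuously_differentiableI[OF h0 h cont])
  show "0 < t \<Longrightarrow> t \<le> n \<Longrightarrow> (deriv ^^ t) (\<lambda>y. f y - c) = (deriv ^^ t) f"
    using iterated_deriv_eqI[OF h0 h cont] by (simp add: h_def)
qed

lemma continuous_on_pos_powr:
  assumes "s > 0"
  shows "continuous_on UNIV (pos_powr s)"
proof -
  have "pos_powr s = (\<lambda>y. max y 0 powr s)"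
    using assms by (auto simp: pos_powr_def max_def)
  then show ?thesis
    using assms by (auto intro!: continuous_on_powr' continuous_on_max)
qed

lemma has_real_derivative_pos_powr:
  assumes s: "s > 1"
  shows "(pos_powr s has_real_derivative s * pos_powr (s - 1) y) (at y)"
proof -
  consider "y > 0" | "y < 0" | "y = 0"
    by linarith
  then show ?thesis
  proof cases
    case 1
    have "((\<lambda>y. y powr s) has_real_derivative s * y powr (s - 1)) (at y)"
      using 1 by (auto intro!: derivative_eq_intros)
    then show ?thesis
      using 1 by (intro has_field_derivative_transform_within_open[of "\<lambda>y. y powr s" _ _ "{0<..}" "pos_powr s"])
         (auto simp: pos_powr_def)
  next
    case 2
    have "((\<lambda>y. 0) has_real_derivative s * pos_powr (s - 1) y) (at y)"
      using 2 by (simp add: pos_powr_def)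
    then show ?thesis
      by (rule has_field_derivative_transform_within_open[of _ _ _ "{..<0}"])
         (use 2 in \<open>auto simp: pos_powr_def\<close>)
  next
    \<comment> \<open>At the origin the difference quotient is itself a truncated power, of exponent
      s - 1 > 0, so it tends to 0 from both sides.\<close>
    case 3
    have "(pos_powr (s - 1) \<longlongrightarrow> pos_powr (s - 1) 0) (at 0)"
      using continuous_on_pos_powr[of "s - 1"] s by (simp add: continuous_on_eq_continuous_at isCont_def)
    moreover have "(pos_powr s (0 + h) - pos_powr s 0) / h = pos_powr (s - 1) h" for h
      by (auto simp: pos_powr_def powr_diff)
    moreover have "s * pos_powr (s - 1) 0 = pos_powr (s - 1) 0"
      by (simp add: pos_powr_def)
    ultimately show ?thesis
      unfolding 3 DERIV_def by (simp only:)
  qed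
qed

text \<open>The bound s > n leaves a positive exponent even after n derivatives, which is what
  continuity at the origin requires.\<close>

lemma pos_powr_derivatives:
  assumes s: "s > real n"
  shows continuously_differentiable_pos_powr: "continuously_differentiable n (pos_powr s)"
    and iterated_deriv_pos_powr:
      "t \<le> n \<Longrightarrow> (deriv ^^ t) (pos_powr s) = (\<lambda>y. (\<Prod>i<t. s - real i) * pos_powr (s - real t) y)"
proof -
  define h where "h = (\<lambda>t y. (\<Prod>i<t. s - real i) * pos_powr (s - real t) y)"
  have h0: "h 0 = pos_powr s"
    by (simp add: h_def fun_eq_iff)
  have h: "(h t has_real_derivative h (Suc t) x) (at x)" if "t < n" for t x
  proof -
    have "s - real t > 1"
      using s that by linarith
    then show ?thesis
      unfolding h_def
      by (auto intro!: derivative_eq_intros has_real_derivative_pos_powr simp: algebra_simps)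
  qed
  have cont: "continuous_on UNIV (h n)"
    unfolding h_def using s by (intro continuous_intros continuous_on_pos_powr) auto
  show "continuously_differentiable n (pos_powr s)"
    by (rule continuously_differentiableI[OF h0 h cont])
  show "t \<le> n \<Longrightarrow> (deriv ^^ t) (pos_powr s) = (\<lambda>y. (\<Prod>i<t. s - real i) * pos_powr (s - real t) y)"
    using iterated_deriv_eqI[OF h0 h cont] by (simp add: h_def)
qed

text \<open>
  The operator \<open>y\<^sup>-\<^sup>1 (y d/dy)\<^sup>n\<close>, written without the division by \<open>y\<close> so that it makes sense at \<open>0\<close>.
\<close>

definition euler_op :: "nat \<Rightarrow> (real \<Rightarrow> real) \<Rightarrow> real \<Rightarrow> real" where
  "euler_op n f y = (\<Sum>k<n. real (Stirling n (Suc k)) * y ^ k * (deriv ^^ Suc k) f y)"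

lemma PN_op_eq_euler_op: "PN_op p s2 f y = s2 * euler_op p f y - y * f y"
proof -
  have "(\<Sum>k=1..p. real (Stirling p k) * y ^ (k - 1) * (deriv ^^ k) f y) = euler_op p f y"
    unfolding euler_op_def
    by (rule sum.reindex_bij_witness[of _ Suc "\<lambda>k. k - 1"]) auto
  then show ?thesis
    by (simp add: PN_op_eq)
qed

lemma euler_op_1: "euler_op (Suc 0) f = deriv f"
  by (simp add: euler_op_def fun_eq_iff)

lemma euler_op_measurable:
  assumes "continuously_differentiable n f"
  shows "euler_op n f \<in> borel_measurable borel"
proof -
  have "(deriv ^^ Suc k) f \<in> borel_measurable borel" if "k < n" for k
    using that by (intro continuously_differentiable_measurable[OF assms]) auto
  then show ?thesis
    unfolding euler_op_def [abs_def] by (intro borel_measurable_sum borel_measurable_times) auto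
qed

lemma continuous_on_euler_op:
  assumes "continuously_differentiable n f"
  shows "continuous_on UNIV (euler_op n f)"
  unfolding euler_op_def [abs_def]
  by (intro continuous_intros continuously_differentiable_continuous[OF assms]) auto

lemma euler_op_dilation:
  assumes "continuously_differentiable n f"
  shows "euler_op n (\<lambda>y. f (r * y)) y = r * euler_op n f (r * y)"
proof -
  have "(deriv ^^ Suc k) (\<lambda>y. f (r * y)) = (\<lambda>y. r ^ Suc k * (deriv ^^ Suc k) f (r * y))" if "k < n" for k
    using that by (intro iterated_deriv_dilation[OF assms]) auto
  then show ?thesis
    unfolding euler_op_def sum_distrib_left
    by (intro sum.cong) (auto simp: power_mult_distrib mult_ac)
qed

lemma euler_op_diff_const:
  assumes "continuously_differentiable n f"
  shows "euler_op n (\<lambda>y. f y - c) y = euler_op n f y"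
proof -
  have "(deriv ^^ Suc k) (\<lambda>y. f y - c) = (deriv ^^ Suc k) f" if "k < n" for k
    using that by (intro iterated_deriv_diff_const[OF assms]) auto
  then show ?thesis
    unfolding euler_op_def by (intro sum.cong) auto
qed

text \<open>With \<open>euler_op n f\<close> read as y^(-1) (y d/dy)^n f, this is euler_op (n + 1) f
  = (y euler_op n f)', and the Stirling recurrence is the same identity for coefficients. The
  recursion starts at n = 1: \<open>euler_op 0 f\<close> is an empty sum, not f(y) / y.\<close>

lemma euler_op_Suc:
  assumes n: "n > 0" and f: "continuously_differentiable (Suc n) f"
  obtains D where "(euler_op n f has_real_derivative D) (at y)"
    and "euler_op (Suc n) f y = euler_op n f y + y * D"
proof -
  let ?S = "\<lambda>k. real (Stirling n k)" and ?d = "\<lambda>k. (deriv ^^ k) f y"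
  define D where "D = (\<Sum>k<n. ?S (Suc k) * (real k * y ^ (k - 1) * ?d (Suc k) + y ^ k * ?d (Suc (Suc k))))"
  have "(euler_op n f has_real_derivative D) (at y)"
    unfolding euler_op_def [abs_def] D_def
  proof (rule DERIV_sum)
    fix k assume "k \<in> {..<n}"
    then have "((deriv ^^ Suc k) f has_real_derivative ?d (Suc (Suc k))) (at y)"
      by (intro continuously_differentiable_has_derivative[OF f]) auto
    then show "((\<lambda>y. ?S (Suc k) * y ^ k * (deriv ^^ Suc k) f y) has_real_derivative
        ?S (Suc k) * (real k * y ^ (k - 1) * ?d (Suc k) + y ^ k * ?d (Suc (Suc k)))) (at y)"
      by (auto intro!: derivative_eq_intros simp: algebra_simps simp del: funpow.simps)
  qed
  moreover have "euler_op (Suc n) f y = euler_op n f y + y * D"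
  proof -
    have "euler_op (Suc n) f y = (\<Sum>k<Suc n. real (Suc k) * ?S (Suc k) * y ^ k * ?d (Suc k)) +
        (\<Sum>k<Suc n. ?S k * y ^ k * ?d (Suc k))"
      unfolding euler_op_def sum.distrib[symmetric]
      by (intro sum.cong) (auto simp: algebra_simps simp del: funpow.simps)
    \<comment> \<open>The top term drops because \<open>Stirling n (Suc n) = 0\<close>; in the next
      sum the bottom term drops because \<open>Stirling n 0 = 0\<close> for n > 0.\<close>
    also have "(\<Sum>k<Suc n. real (Suc k) * ?S (Suc k) * y ^ k * ?d (Suc k)) =
        (\<Sum>k<n. real (Suc k) * ?S (Suc k) * y ^ k * ?d (Suc k))"
      by simp
    also have "(\<Sum>k<Suc n. ?S k * y ^ k * ?d (Suc k)) = (\<Sum>k<n. ?S (Suc k) * y ^ Suc k * ?d (Suc (Suc k)))"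
      using n by (subst sum.lessThan_Suc_shift) (cases n; simp del: funpow.simps power_Suc)
    also have "(\<Sum>k<n. real (Suc k) * ?S (Suc k) * y ^ k * ?d (Suc k)) +
        (\<Sum>k<n. ?S (Suc k) * y ^ Suc k * ?d (Suc (Suc k))) = euler_op n f y + y * D"
    proof -
      show ?thesis
        unfolding euler_op_def D_def sum_distrib_left sum.distrib[symmetric]
      proof (intro sum.cong refl)
        fix k
        show "real (Suc k) * ?S (Suc k) * y ^ k * ?d (Suc k) + ?S (Suc k) * y ^ Suc k * ?d (Suc (Suc k)) =
          ?S (Suc k) * y ^ k * ?d (Suc k) +
          y * (?S (Suc k) * (real k * y ^ (k - 1) * ?d (Suc k) + y ^ k * ?d (Suc (Suc k))))"
          by (cases k) (simp_all add: algebra_simps del: funpow.simps)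
      qed
    qed
    finally show ?thesis .
  qed
  ultimately show thesis
    by (rule that)
qed

text \<open>The assumption makes f an eigenfunction of y d/dy, so every further application
  contributes a factor s. Keeping \<open>deriv f y\<close> in place of s f(y) / y makes the formula
  valid at y = 0.\<close>

lemma euler_op_homogeneous:
  assumes f: "continuously_differentiable (Suc n) f" and hom: "\<And>y. y * deriv f y = s * f y"
  shows "euler_op (Suc n) f y = s ^ n * deriv f y"
  using f
proof (induction n arbitrary: y)
  case 0
  then show ?case
    by (simp add: euler_op_1)
next
  case (Suc n)
  have IH: "euler_op (Suc n) f y = s ^ n * deriv f y" for y
    by (rule Suc.IH[OF continuously_differentiable_mono[OF Suc.prems]]) simp
  obtain D where D: "(euler_op (Suc n) f has_real_derivative D) (at y)"
      "euler_op (Suc (Suc n)) f y = euler_op (Suc n) f y + y * D"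
    by (rule euler_op_Suc[OF _ Suc.prems, of y]) auto
  \<comment> \<open>The derivative of y euler_op f is found in two ways, by the recursion and from
    the closed form s^(n+1) f; nothing is divided by y.\<close>
  have "((\<lambda>y. y * euler_op (Suc n) f y) has_real_derivative euler_op (Suc (Suc n)) f y) (at y)"
    unfolding D(2) by (rule DERIV_cong[OF DERIV_mult[OF DERIV_ident D(1)]]) simp
  moreover have "(\<lambda>y. y * euler_op (Suc n) f y) = (\<lambda>y. s ^ Suc n * f y)"
  proof
    fix y
    have "y * euler_op (Suc n) f y = s ^ n * (y * deriv f y)"
      by (simp only: IH mult_ac)
    then show "y * euler_op (Suc n) f y = s ^ Suc n * f y"
      by (simp add: hom)
  qed
  moreover have "((\<lambda>y. s ^ Suc n * f y) has_real_derivative s ^ Suc n * deriv f y) (at y)"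
    using continuously_differentiable_has_derivative[OF Suc.prems, of 0 y]
    by (intro DERIV_cmult) simp
  ultimately show ?case
    by (simp only: DERIV_unique)
qed

subsection \<open>Integration by parts for products of normal variables\<close>

lemma normal_density_has_derivative:
  "\<sigma> > 0 \<Longrightarrow> (normal_density 0 \<sigma> has_real_derivative - x / \<sigma>\<^sup>2 * normal_density 0 \<sigma> x) (at x)"
  unfolding normal_density_def [abs_def]
  by (auto intro!: derivative_eq_intros simp: field_simps power2_eq_square)

lemma normal_density_tendsto_0: "\<sigma> > 0 \<Longrightarrow> (normal_density 0 \<sigma> \<longlongrightarrow> 0) at_top"
  unfolding normal_density_def [abs_def] by real_asymp

lemma normal_tail_first_moment:
  assumes \<sigma>: "\<sigma> > 0" and s: "s \<ge> 0"
  shows "(\<integral>\<^sup>+x. ennreal (normal_density 0 \<sigma> x * x) * indicator {s..} x \<partial>lborel) = ennreal (\<sigma>\<^sup>2 * normal_density 0 \<sigma> s)"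
proof -
  have lim: "((\<lambda>x. - (\<sigma>\<^sup>2 * normal_density 0 \<sigma> x)) \<longlongrightarrow> - (\<sigma>\<^sup>2 * 0)) at_top"
    by (intro tendsto_intros normal_density_tendsto_0 \<sigma>)
  have "(\<integral>\<^sup>+x. ennreal (normal_density 0 \<sigma> x * x) * indicator {s..} x \<partial>lborel) =
      - (\<sigma>\<^sup>2 * 0) - (- (\<sigma>\<^sup>2 * normal_density 0 \<sigma> s))"
  proof (rule nn_integral_FTC_atLeast[OF _ _ _ lim])
    fix x assume "s \<le> x"
    then show "0 \<le> normal_density 0 \<sigma> x * x"
      using s by simp
    show "((\<lambda>x. - (\<sigma>\<^sup>2 * normal_density 0 \<sigma> x)) has_real_derivative normal_density 0 \<sigma> x * x) (at x)"
      using \<sigma> by (auto intro!: derivative_eq_intros normal_density_has_derivative)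
  qed simp
  then show ?thesis
    by simp
qed

lemma normal_density_even: "normal_density 0 \<sigma> (- x) = normal_density 0 \<sigma> x"
  by (simp add: normal_density_def)

text \<open>For h' >= 0 the product x h(x) is |x| times the integral of h' over the segment between
  0 and x. All quantities are nonnegative, so Tonelli's theorem needs no integrability, and
  integrating over x first leaves the tail moment \<sigma>^2 \<phi>(s).\<close>

lemma normal_stein_nonneg:
  assumes \<sigma>: "\<sigma> > 0" and h0: "h 0 = 0" and h: "\<And>x. (h has_real_derivative h' x) (at x)"
    and cont: "continuous_on UNIV h'" and nonneg: "\<And>x. 0 \<le> h' x"
  defines "N \<equiv> density lborel (\<lambda>x. ennreal (normal_density 0 \<sigma> x))"
  shows "(\<integral>\<^sup>+x. ennreal (x * h x) \<partial>N) = ennreal (\<sigma>\<^sup>2) * (\<integral>\<^sup>+x. ennreal (h' x) \<partial>N)"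
    and "0 \<le> x * h x"
proof -
  let ?\<phi> = "normal_density 0 \<sigma>"
  have [measurable]: "h' \<in> borel_measurable borel"
    by (rule borel_measurable_continuous_onI[OF cont])
  have [measurable]: "h \<in> borel_measurable borel"
    by (intro borel_measurable_continuous_onI DERIV_continuous_on h) (use h in \<open>blast intro: has_field_derivative_at_within\<close>)
  have mono: "h x \<le> h y" if "x \<le> y" for x y
    using that h nonneg by (blast intro: DERIV_nonneg_imp_nondecreasing)
  show "0 \<le> x * h x"
    using mono[of 0 x] mono[of x 0] h0 by (cases "x \<ge> 0") (auto simp: mult_nonpos_nonpos)
  \<comment> \<open>The weight |x| on the segment between 0 and x, for either sign of x.\<close>
  define k :: "real \<Rightarrow> real \<Rightarrow> ennreal" where
    "k x s = (if 0 \<le> s \<and> s \<le> x \<or> x \<le> s \<and> s \<le> 0 then ennreal \<bar>x\<bar> else 0)" for x s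
  have [measurable]: "(\<lambda>(x, s). k x s) \<in> borel_measurable (borel \<Otimes>\<^sub>M borel)"
    unfolding k_def by measurable
  have FTC: "(\<integral>\<^sup>+s. ennreal (h' s) * indicator {a..b} s \<partial>lborel) = ennreal (h b - h a)" if "a \<le> b" for a b
    using that h nonneg by (intro nn_integral_FTC_Icc) auto
  have repr: "ennreal (x * h x) = (\<integral>\<^sup>+s. ennreal (h' s) * k x s \<partial>lborel)" for x
  proof (cases "x \<ge> 0")
    case True
    have "(\<integral>\<^sup>+s. ennreal (h' s) * k x s \<partial>lborel) = (\<integral>\<^sup>+s. ennreal x * (ennreal (h' s) * indicator {0..x} s) \<partial>lborel)"
      using True by (intro nn_integral_cong) (auto simp: k_def indicator_def mult.commute)
    also have "\<dots> = ennreal x * ennreal (h x - h 0)"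
      using True by (simp add: nn_integral_cmult FTC)
    finally show ?thesis
      using True h0 mono[of 0 x] by (simp add: ennreal_mult)
  next
    case False
    have "(\<integral>\<^sup>+s. ennreal (h' s) * k x s \<partial>lborel) = (\<integral>\<^sup>+s. ennreal (- x) * (ennreal (h' s) * indicator {x..0} s) \<partial>lborel)"
      using False by (intro nn_integral_cong) (auto simp: k_def indicator_def mult.commute)
    also have "\<dots> = ennreal (- x) * ennreal (h 0 - h x)"
      using False by (simp add: nn_integral_cmult FTC)
    finally show ?thesis
      using False h0 mono[of x 0] by (simp add: ennreal_mult[symmetric])
  qed
  \<comment> \<open>At s = 0 both half-lines would contribute and double the value; this single
    point is a null set. Negative s is reduced to positive s by x -> -x.\<close>
  have kernel: "(\<integral>\<^sup>+x. ennreal (?\<phi> x) * k x s \<partial>lborel) = ennreal (\<sigma>\<^sup>2 * ?\<phi> s)" if "s \<noteq> 0" for s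
  proof (cases "s > 0")
    case True
    have "(\<integral>\<^sup>+x. ennreal (?\<phi> x) * k x s \<partial>lborel) = (\<integral>\<^sup>+x. ennreal (?\<phi> x * x) * indicator {s..} x \<partial>lborel)"
      using True by (intro nn_integral_cong) (auto simp: k_def indicator_def ennreal_mult[symmetric])
    then show ?thesis
      using normal_tail_first_moment[OF \<sigma>, of s] True by simp
  next
    case False
    have "(\<integral>\<^sup>+x. ennreal (?\<phi> x) * k x s \<partial>lborel) = (\<integral>\<^sup>+x. ennreal (?\<phi> (0 + (-1) * x)) * k (0 + (-1) * x) s \<partial>lborel)"
      by (subst nn_integral_real_affine[where c = "-1" and t = 0]) auto
    also have "\<dots> = (\<integral>\<^sup>+x. ennreal (?\<phi> x * x) * indicator {- s..} x \<partial>lborel)"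
      using False that by (intro nn_integral_cong) (auto simp: k_def indicator_def ennreal_mult[symmetric] normal_density_even)
    finally show ?thesis
      using normal_tail_first_moment[OF \<sigma>, of "- s"] False that by (simp add: normal_density_even)
  qed
  have "(\<integral>\<^sup>+x. ennreal (x * h x) \<partial>N) = (\<integral>\<^sup>+x. ennreal (?\<phi> x) * (\<integral>\<^sup>+s. ennreal (h' s) * k x s \<partial>lborel) \<partial>lborel)"
    by (simp add: N_def nn_integral_density repr)
  also have "\<dots> = (\<integral>\<^sup>+x. (\<integral>\<^sup>+s. ennreal (h' s) * (ennreal (?\<phi> x) * k x s) \<partial>lborel) \<partial>lborel)"
    by (subst nn_integral_cmult[symmetric]) (auto intro!: nn_integral_cong simp: mult_ac)
  also have "\<dots> = (\<integral>\<^sup>+s. (\<integral>\<^sup>+x. ennreal (h' s) * (ennreal (?\<phi> x) * k x s) \<partial>lborel) \<partial>lborel)"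
    by (rule lborel_pair.Fubini'[symmetric]) measurable
  also have "\<dots> = (\<integral>\<^sup>+s. ennreal (h' s) * (\<integral>\<^sup>+x. ennreal (?\<phi> x) * k x s \<partial>lborel) \<partial>lborel)"
    by (simp add: nn_integral_cmult)
  also have "\<dots> = (\<integral>\<^sup>+s. ennreal (\<sigma>\<^sup>2) * (ennreal (?\<phi> s) * ennreal (h' s)) \<partial>lborel)"
    using AE_lborel_singleton[of 0]
    by (intro nn_integral_cong_AE, eventually_elim) (simp add: kernel ennreal_mult, simp only: mult_ac)
  also have "\<dots> = ennreal (\<sigma>\<^sup>2) * (\<integral>\<^sup>+x. ennreal (h' x) \<partial>N)"
    by (simp add: N_def nn_integral_density nn_integral_cmult)
  finally show "(\<integral>\<^sup>+x. ennreal (x * h x) \<partial>N) = ennreal (\<sigma>\<^sup>2) * (\<integral>\<^sup>+x. ennreal (h' x) \<partial>N)" .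
qed

lemma continuous_antiderivative:
  fixes g :: "real \<Rightarrow> real"
  assumes "continuous_on UNIV g"
  obtains G where "G 0 = 0" "\<And>x. (G has_real_derivative g x) (at x)"
proof -
  obtain F where F: "\<And>x. (F has_vector_derivative g x) (at x)"
    using einterval_antiderivative[of "-\<infinity>" "\<infinity>" g] assms by (auto simp: continuous_on_eq_continuous_at)
  show thesis
  proof (rule that[of "\<lambda>x. F x - F 0"])
    show "((\<lambda>x. F x - F 0) has_real_derivative g x) (at x)" for x
      using F[of x] by (auto simp: has_real_derivative_iff_has_vector_derivative intro!: derivative_eq_intros)
  qed simp
qed

text \<open>Integrating the positive and negative parts of h' from 0 writes h as a difference of two
  monotone functions, each covered by the nonnegative case. The bound holds in [0, \<infinity>]
  without integrability, which is how finiteness is later obtained rather than presupposed.\<close>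

lemma normal_stein:
  assumes \<sigma>: "\<sigma> > 0" and h0: "h 0 = 0" and h: "\<And>x. (h has_real_derivative h' x) (at x)"
    and cont: "continuous_on UNIV h'"
  defines "N \<equiv> density lborel (\<lambda>x. ennreal (normal_density 0 \<sigma> x))"
  shows normal_stein_bound:
      "(\<integral>\<^sup>+x. ennreal \<bar>x * h x\<bar> \<partial>N) \<le> ennreal (\<sigma>\<^sup>2) * (\<integral>\<^sup>+x. ennreal \<bar>h' x\<bar> \<partial>N)"
    and normal_stein_eq: "integrable N h' \<Longrightarrow> (\<integral>x. x * h x \<partial>N) = \<sigma>\<^sup>2 * (\<integral>x. h' x \<partial>N)"
proof -
  have [measurable]: "h' \<in> borel_measurable borel"
    by (rule borel_measurable_continuous_onI[OF cont])
  have cont12: "continuous_on UNIV (\<lambda>x. max (h' x) 0)" "continuous_on UNIV (\<lambda>x. max (- h' x) 0)"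
    by (intro continuous_intros cont continuous_on_max)+
  obtain h1 where h1: "h1 0 = 0" "\<And>x. (h1 has_real_derivative max (h' x) 0) (at x)"
    using continuous_antiderivative[OF cont12(1)] by blast
  obtain h2 where h2: "h2 0 = 0" "\<And>x. (h2 has_real_derivative max (- h' x) 0) (at x)"
    using continuous_antiderivative[OF cont12(2)] by blast
  have [measurable]: "h1 \<in> borel_measurable borel" "h2 \<in> borel_measurable borel"
    by (intro borel_measurable_continuous_onI DERIV_continuous_on; 
        use h1 h2 in \<open>blast intro: has_field_derivative_at_within\<close>)+
  have h_eq: "h x = h1 x - h2 x" for x
  proof -
    have "((\<lambda>x. h x - (h1 x - h2 x)) has_real_derivative 0) (at x)" for x
      by (rule DERIV_cong[OF DERIV_diff[OF h DERIV_diff[OF h1(2) h2(2)]]]) (auto simp: max_def)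
    then have "h x - (h1 x - h2 x) = h 0 - (h1 0 - h2 0)"
      using DERIV_isconst_all[of "\<lambda>x. h x - (h1 x - h2 x)"] by blast
    then show ?thesis
      by (simp add: h0 h1(1) h2(1))
  qed
  note s1 = normal_stein_nonneg[OF \<sigma> h1 cont12(1), folded N_def, simplified]
  note s2 = normal_stein_nonneg[OF \<sigma> h2 cont12(2), folded N_def, simplified]
  have "(\<integral>\<^sup>+x. ennreal \<bar>x * h x\<bar> \<partial>N) \<le> (\<integral>\<^sup>+x. ennreal (x * h1 x) + ennreal (x * h2 x) \<partial>N)"
  proof (intro nn_integral_mono)
    fix x
    have "\<bar>x * h x\<bar> \<le> x * h1 x + x * h2 x"
      using s1(2)[of x] s2(2)[of x] by (simp add: h_eq algebra_simps abs_le_iff)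
    then show "ennreal \<bar>x * h x\<bar> \<le> ennreal (x * h1 x) + ennreal (x * h2 x)"
      using s1(2)[of x] s2(2)[of x] by (simp flip: ennreal_plus)
  qed
  also have "\<dots> = ennreal (\<sigma>\<^sup>2) * (\<integral>\<^sup>+x. ennreal (max (h' x) 0) + ennreal (max (- h' x) 0) \<partial>N)"
    unfolding N_def
    by (simp add: nn_integral_add s1(1)[unfolded N_def] s2(1)[unfolded N_def] distrib_left)
  also have "(\<integral>\<^sup>+x. ennreal (max (h' x) 0) + ennreal (max (- h' x) 0) \<partial>N) = (\<integral>\<^sup>+x. ennreal \<bar>h' x\<bar> \<partial>N)"
    by (intro nn_integral_cong) (auto simp: max_def simp flip: ennreal_plus)
  finally show "(\<integral>\<^sup>+x. ennreal \<bar>x * h x\<bar> \<partial>N) \<le> ennreal (\<sigma>\<^sup>2) * (\<integral>\<^sup>+x. ennreal \<bar>h' x\<bar> \<partial>N)" .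
  assume int: "integrable N h'"
  have int12: "integrable N (\<lambda>x. max (h' x) 0)" "integrable N (\<lambda>x. max (- h' x) 0)"
    using int by auto
  have step: "integrable N (\<lambda>x. x * H x) \<and> (\<integral>x. x * H x \<partial>N) = \<sigma>\<^sup>2 * (\<integral>x. H' x \<partial>N)"
    if [measurable]: "H \<in> borel_measurable borel" and H': "integrable N H'" "\<And>x. 0 \<le> H' x" "\<And>x. 0 \<le> x * H x"
      and eq: "(\<integral>\<^sup>+x. ennreal (x * H x) \<partial>N) = ennreal (\<sigma>\<^sup>2) * (\<integral>\<^sup>+x. ennreal (H' x) \<partial>N)" for H H'
  proof -
    have "(\<integral>\<^sup>+x. ennreal (x * H x) \<partial>N) = ennreal (\<sigma>\<^sup>2 * (\<integral>x. H' x \<partial>N))"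
      using H' by (simp add: eq nn_integral_eq_integral ennreal_mult)
    moreover have "0 \<le> \<sigma>\<^sup>2 * (\<integral>x. H' x \<partial>N)"
      using H' by simp
    moreover have "(\<lambda>x. x * H x) \<in> borel_measurable N"
      by (simp add: N_def)
    ultimately have "has_bochner_integral N (\<lambda>x. x * H x) (\<sigma>\<^sup>2 * (\<integral>x. H' x \<partial>N))"
      using H'(3) by (intro has_bochner_integral_nn_integral) auto
    then show ?thesis
      by (auto simp: has_bochner_integral_iff)
  qed
  have st1: "integrable N (\<lambda>x. x * h1 x) \<and> (\<integral>x. x * h1 x \<partial>N) = \<sigma>\<^sup>2 * (\<integral>x. max (h' x) 0 \<partial>N)"
    by (rule step) (use int12 s1 in auto)
  have st2: "integrable N (\<lambda>x. x * h2 x) \<and> (\<integral>x. x * h2 x \<partial>N) = \<sigma>\<^sup>2 * (\<integral>x. max (- h' x) 0 \<partial>N)"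
    by (rule step) (use int12 s2 in auto)
  have "(\<integral>x. x * h x \<partial>N) = (\<integral>x. x * h1 x - x * h2 x \<partial>N)"
    by (simp add: h_eq algebra_simps)
  also have "\<dots> = \<sigma>\<^sup>2 * ((\<integral>x. max (h' x) 0 \<partial>N) - (\<integral>x. max (- h' x) 0 \<partial>N))"
    using st1 st2 by (simp add: algebra_simps)
  also have "(\<integral>x. max (h' x) 0 \<partial>N) - (\<integral>x. max (- h' x) 0 \<partial>N) = (\<integral>x. max (h' x) 0 - max (- h' x) 0 \<partial>N)"
    using int12 by simp
  also have "\<dots> = (\<integral>x. h' x \<partial>N)"
    by (intro Bochner_Integration.integral_cong) (auto simp: max_def)
  finally show "(\<integral>x. x * h x \<partial>N) = \<sigma>\<^sup>2 * (\<integral>x. h' x \<partial>N)" .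
qed

section \<open>Induction over the normal factors\<close>

text \<open>The inequality belongs to the induction hypothesis: integrability is given only for the
  top-order expression and has to be handed down to the lower ones. The condition f 0 = 0 excludes
  nonzero constants, for which the bound would fail in general, and it survives dilations.\<close>

definition mult_stein :: "nat \<Rightarrow> real \<Rightarrow> real measure \<Rightarrow> bool" where
  "mult_stein n s \<mu> \<longleftrightarrow> (\<forall>f. continuously_differentiable n f \<and> f 0 = 0 \<longrightarrow>
     (\<integral>\<^sup>+y. ennreal \<bar>y * f y\<bar> \<partial>\<mu>) \<le> ennreal s * (\<integral>\<^sup>+y. ennreal \<bar>euler_op n f y\<bar> \<partial>\<mu>) \<and>
     (integrable \<mu> (euler_op n f) \<longrightarrow> (\<integral>y. y * f y \<partial>\<mu>) = s * (\<integral>y. euler_op n f y \<partial>\<mu>)))"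

lemma mult_stein_normal:
  assumes "\<sigma> > 0"
  shows "mult_stein (Suc 0) (\<sigma>\<^sup>2) (density lborel (\<lambda>x. ennreal (normal_density 0 \<sigma> x)))"
  unfolding mult_stein_def euler_op_1
proof (intro allI impI conjI; elim conjE)
  fix f assume f: "continuously_differentiable (Suc 0) f" "f 0 = 0"
  have d: "(f has_real_derivative deriv f x) (at x)" for x
    using continuously_differentiable_has_derivative[OF f(1), of 0 x] by simp
  have c: "continuous_on UNIV (deriv f)"
    using continuously_differentiable_continuous[OF f(1), of "Suc 0"] by simp
  let ?N = "density lborel (\<lambda>x. ennreal (normal_density 0 \<sigma> x))"
  show "(\<integral>\<^sup>+y. ennreal \<bar>y * f y\<bar> \<partial>?N) \<le> ennreal (\<sigma>\<^sup>2) * (\<integral>\<^sup>+y. ennreal \<bar>deriv f y\<bar> \<partial>?N)"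
    by (rule normal_stein_bound[OF assms f(2) d c])
  show "(\<integral>y. y * f y \<partial>?N) = \<sigma>\<^sup>2 * (\<integral>y. deriv f y \<partial>?N)" if "integrable ?N (deriv f)"
    by (rule normal_stein_eq[OF assms f(2) d c that])
qed

text \<open>With A = euler_op n f and B = euler_op (n + 1) f: for fixed x the assumption on \<mu> is
  applied to y -> f(x y), which produces x A(x y); for fixed y the normal identity is applied to x
  -> x A(x y), which vanishes at 0 and has derivative B(x y).\<close>

lemma mult_stein_mult:
  fixes \<mu> :: "real measure"
  assumes prob: "prob_space \<mu>" and sets_mu [measurable_cong]: "sets \<mu> = sets borel"
    and \<mu>: "mult_stein n s \<mu>" and n: "n > 0" and s: "s \<ge> 0" and \<sigma>: "\<sigma> > 0"
  defines "N \<equiv> density lborel (\<lambda>x. ennreal (normal_density 0 \<sigma> x))"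
  shows "mult_stein (Suc n) (\<sigma>\<^sup>2 * s) (distr (N \<Otimes>\<^sub>M \<mu>) borel (\<lambda>(x, y). x * y))"
  unfolding mult_stein_def
proof (intro allI impI; elim conjE)
  fix f assume f: "continuously_differentiable (Suc n) f" and f0: "f 0 = 0"
  interpret N: prob_space N
    unfolding N_def using \<sigma> by (rule prob_space_normal_density)
  interpret \<mu>: prob_space \<mu> by fact
  interpret P: pair_prob_space N \<mu> ..
  have sets_N [measurable_cong]: "sets N = sets borel"
    by (simp add: N_def)
  have f': "continuously_differentiable n f"
    using f by (rule continuously_differentiable_mono) simp
  define A where "A = euler_op n f"
  define B where "B = euler_op (Suc n) f"
  have f_meas [measurable]: "f \<in> borel_measurable borel"
    using continuously_differentiable_measurable[OF f, of 0] by simp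
  have [measurable]: "A \<in> borel_measurable borel" "B \<in> borel_measurable borel"
    unfolding A_def B_def by (intro euler_op_measurable f f')+
  have contB: "continuous_on UNIV (\<lambda>x. B (x * y))" for y
    unfolding B_def
    by (intro continuous_on_compose2[OF continuous_on_euler_op[OF f]] continuous_intros) auto
  have derivA: "((\<lambda>x. x * A (x * y)) has_real_derivative B (x * y)) (at x)" for x y
  proof -
    obtain D where D: "(A has_real_derivative D) (at (x * y))" "B (x * y) = A (x * y) + x * y * D"
      unfolding A_def B_def by (rule euler_op_Suc[OF n f])
    have "((\<lambda>x. A (x * y)) has_real_derivative D * y) (at x)"
      by (rule DERIV_chain2[where f = A and g = "\<lambda>x. x * y", OF D(1)]) (auto intro!: derivative_eq_intros)
    from DERIV_mult[OF DERIV_ident this] show ?thesis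
      by (rule DERIV_cong) (simp add: D(2) mult_ac)
  qed
  have outer: "(\<integral>\<^sup>+x. ennreal \<bar>x * (x * A (x * y))\<bar> \<partial>N) \<le> ennreal (\<sigma>\<^sup>2) * (\<integral>\<^sup>+x. ennreal \<bar>B (x * y)\<bar> \<partial>N)" for y
    unfolding N_def by (rule normal_stein_bound[OF \<sigma> _ derivA contB]) simp
  have outer_eq: "(\<integral>x. x * (x * A (x * y)) \<partial>N) = \<sigma>\<^sup>2 * (\<integral>x. B (x * y) \<partial>N)"
    if "integrable N (\<lambda>x. B (x * y))" for y
    using that unfolding N_def by (intro normal_stein_eq[OF \<sigma> _ derivA contB]) auto
  have cd: "continuously_differentiable n (\<lambda>y. f (x * y)) \<and> f (x * 0) = 0" for x
    using continuously_differentiable_dilation[OF f'] f0 by simp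
  note dil = euler_op_dilation[OF f', folded A_def]
  have inner: "(\<integral>\<^sup>+y. ennreal \<bar>y * f (x * y)\<bar> \<partial>\<mu>) \<le> ennreal s * (\<integral>\<^sup>+y. ennreal \<bar>x * A (x * y)\<bar> \<partial>\<mu>)" for x
    using \<mu> cd[of x] unfolding mult_stein_def dil[symmetric] by blast
  have inner_eq: "(\<integral>y. y * f (x * y) \<partial>\<mu>) = s * (\<integral>y. x * A (x * y) \<partial>\<mu>)"
    if "integrable \<mu> (\<lambda>y. x * A (x * y))" for x
    using \<mu> cd[of x] that unfolding mult_stein_def dil[symmetric] by blast
  \<comment> \<open>Together with \<open>b2\<close> this carries finiteness backwards, from B(x y)
    to x^2 A(x y) to x y f(x y), so that all three are integrable on the product space before any
    integrals are interchanged.\<close>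
  have b1: "(\<integral>\<^sup>+z. ennreal \<bar>case z of (x, y) \<Rightarrow> x * y * f (x * y)\<bar> \<partial>(N \<Otimes>\<^sub>M \<mu>)) \<le>
      ennreal s * (\<integral>\<^sup>+z. ennreal \<bar>case z of (x, y) \<Rightarrow> x * (x * A (x * y))\<bar> \<partial>(N \<Otimes>\<^sub>M \<mu>))"
  proof -
    have "(\<integral>\<^sup>+z. ennreal \<bar>case z of (x, y) \<Rightarrow> x * y * f (x * y)\<bar> \<partial>(N \<Otimes>\<^sub>M \<mu>)) =
        (\<integral>\<^sup>+x. (\<integral>\<^sup>+y. ennreal \<bar>x\<bar> * ennreal \<bar>y * f (x * y)\<bar> \<partial>\<mu>) \<partial>N)"
      by (subst \<mu>.nn_integral_fst[symmetric]) (auto simp: ennreal_mult[symmetric] abs_mult mult_ac intro!: nn_integral_cong)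
    also have "\<dots> = (\<integral>\<^sup>+x. ennreal \<bar>x\<bar> * (\<integral>\<^sup>+y. ennreal \<bar>y * f (x * y)\<bar> \<partial>\<mu>) \<partial>N)"
      by (simp add: nn_integral_cmult)
    also have "\<dots> \<le> (\<integral>\<^sup>+x. ennreal \<bar>x\<bar> * (ennreal s * (\<integral>\<^sup>+y. ennreal \<bar>x * A (x * y)\<bar> \<partial>\<mu>)) \<partial>N)"
      by (intro nn_integral_mono mult_left_mono inner) auto
    also have "\<dots> = (\<integral>\<^sup>+x. ennreal s * (\<integral>\<^sup>+y. ennreal \<bar>x\<bar> * ennreal \<bar>x * A (x * y)\<bar> \<partial>\<mu>) \<partial>N)"
      by (simp add: nn_integral_cmult mult_ac)
    also have "\<dots> = ennreal s * (\<integral>\<^sup>+x. (\<integral>\<^sup>+y. ennreal \<bar>x * (x * A (x * y))\<bar> \<partial>\<mu>) \<partial>N)"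
      by (simp add: nn_integral_cmult ennreal_mult[symmetric] abs_mult)
    also have "(\<integral>\<^sup>+x. (\<integral>\<^sup>+y. ennreal \<bar>x * (x * A (x * y))\<bar> \<partial>\<mu>) \<partial>N) =
        (\<integral>\<^sup>+z. ennreal \<bar>case z of (x, y) \<Rightarrow> x * (x * A (x * y))\<bar> \<partial>(N \<Otimes>\<^sub>M \<mu>))"
      by (subst \<mu>.nn_integral_fst[symmetric]) auto
    finally show ?thesis .
  qed
  have b2: "(\<integral>\<^sup>+z. ennreal \<bar>case z of (x, y) \<Rightarrow> x * (x * A (x * y))\<bar> \<partial>(N \<Otimes>\<^sub>M \<mu>)) \<le>
      ennreal (\<sigma>\<^sup>2) * (\<integral>\<^sup>+z. ennreal \<bar>case z of (x, y) \<Rightarrow> B (x * y)\<bar> \<partial>(N \<Otimes>\<^sub>M \<mu>))"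
  proof -
    have "(\<integral>\<^sup>+z. ennreal \<bar>case z of (x, y) \<Rightarrow> x * (x * A (x * y))\<bar> \<partial>(N \<Otimes>\<^sub>M \<mu>)) =
        (\<integral>\<^sup>+y. (\<integral>\<^sup>+x. ennreal \<bar>x * (x * A (x * y))\<bar> \<partial>N) \<partial>\<mu>)"
      by (subst P.nn_integral_snd[symmetric]) auto
    also have "\<dots> \<le> (\<integral>\<^sup>+y. ennreal (\<sigma>\<^sup>2) * (\<integral>\<^sup>+x. ennreal \<bar>B (x * y)\<bar> \<partial>N) \<partial>\<mu>)"
      by (intro nn_integral_mono outer)
    also have "\<dots> = ennreal (\<sigma>\<^sup>2) * (\<integral>\<^sup>+y. (\<integral>\<^sup>+x. ennreal \<bar>B (x * y)\<bar> \<partial>N) \<partial>\<mu>)"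
      by (simp add: nn_integral_cmult)
    also have "(\<integral>\<^sup>+y. (\<integral>\<^sup>+x. ennreal \<bar>B (x * y)\<bar> \<partial>N) \<partial>\<mu>) =
        (\<integral>\<^sup>+z. ennreal \<bar>case z of (x, y) \<Rightarrow> B (x * y)\<bar> \<partial>(N \<Otimes>\<^sub>M \<mu>))"
      by (subst P.nn_integral_snd[symmetric]) auto
    finally show ?thesis .
  qed
  let ?D = "distr (N \<Otimes>\<^sub>M \<mu>) borel (\<lambda>(x, y). x * y)"
  show "(\<integral>\<^sup>+y. ennreal \<bar>y * f y\<bar> \<partial>?D) \<le> ennreal (\<sigma>\<^sup>2 * s) * (\<integral>\<^sup>+y. ennreal \<bar>euler_op (Suc n) f y\<bar> \<partial>?D) \<and>
     (integrable ?D (euler_op (Suc n) f) \<longrightarrow> (\<integral>y. y * f y \<partial>?D) = \<sigma>\<^sup>2 * s * (\<integral>y. euler_op (Suc n) f y \<partial>?D))"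
  proof (intro conjI impI)
    have "(\<integral>\<^sup>+z. ennreal \<bar>case z of (x, y) \<Rightarrow> x * y * f (x * y)\<bar> \<partial>(N \<Otimes>\<^sub>M \<mu>)) \<le>
      ennreal s * (ennreal (\<sigma>\<^sup>2) * (\<integral>\<^sup>+z. ennreal \<bar>case z of (x, y) \<Rightarrow> B (x * y)\<bar> \<partial>(N \<Otimes>\<^sub>M \<mu>)))"
      using b1 mult_left_mono[OF b2, of "ennreal s"] by (auto intro: order_trans)
    then show "(\<integral>\<^sup>+y. ennreal \<bar>y * f y\<bar> \<partial>?D) \<le> ennreal (\<sigma>\<^sup>2 * s) * (\<integral>\<^sup>+y. ennreal \<bar>euler_op (Suc n) f y\<bar> \<partial>?D)"
      unfolding B_def[symmetric] using s
      by (simp add: nn_integral_distr split_beta' ennreal_mult mult_ac)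
  next
    assume "integrable ?D (euler_op (Suc n) f)"
    then have intB: "integrable (N \<Otimes>\<^sub>M \<mu>) (\<lambda>(x, y). B (x * y))"
      unfolding B_def[symmetric] by (simp add: integrable_distr_eq split_beta')
    then have finB: "(\<integral>\<^sup>+z. ennreal \<bar>case z of (x, y) \<Rightarrow> B (x * y)\<bar> \<partial>(N \<Otimes>\<^sub>M \<mu>)) < \<infinity>"
      by (simp add: integrable_iff_bounded split_beta')
    have intA: "integrable (N \<Otimes>\<^sub>M \<mu>) (\<lambda>(x, y). x * (x * A (x * y)))"
      using le_less_trans[OF b2] finB by (simp add: integrable_iff_bounded split_beta' ennreal_mult_less_top)
    then have finA: "(\<integral>\<^sup>+z. ennreal \<bar>case z of (x, y) \<Rightarrow> x * (x * A (x * y))\<bar> \<partial>(N \<Otimes>\<^sub>M \<mu>)) < \<infinity>"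
      by (simp add: integrable_iff_bounded split_beta')
    have intf: "integrable (N \<Otimes>\<^sub>M \<mu>) (\<lambda>(x, y). x * y * f (x * y))"
      using le_less_trans[OF b1] finA by (simp add: integrable_iff_bounded split_beta' ennreal_mult_less_top)
    have "(\<integral>y. y * f y \<partial>?D) = (\<integral>z. (case z of (x, y) \<Rightarrow> x * y * f (x * y)) \<partial>(N \<Otimes>\<^sub>M \<mu>))"
      by (simp add: integral_distr split_beta')
    also have "\<dots> = (\<integral>x. (\<integral>y. x * y * f (x * y) \<partial>\<mu>) \<partial>N)"
      using P.integral_fst[OF intf] by simp
    also have "\<dots> = (\<integral>x. s * (\<integral>y. x * (x * A (x * y)) \<partial>\<mu>) \<partial>N)"
    proof (intro integral_cong_AE)
      show "AE x in N. (\<integral>y. x * y * f (x * y) \<partial>\<mu>) = s * (\<integral>y. x * (x * A (x * y)) \<partial>\<mu>)"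
        using P.AE_integrable_fst[OF intA]
      proof eventually_elim
        fix x assume *: "integrable \<mu> (\<lambda>y. x * (x * A (x * y)))"
        show "(\<integral>y. x * y * f (x * y) \<partial>\<mu>) = s * (\<integral>y. x * (x * A (x * y)) \<partial>\<mu>)"
        \<comment> \<open>The factor x can be cancelled from the integrability statement only for x
          \<noteq> 0; at x = 0 both sides vanish.\<close>
        proof (cases "x = 0")
          case False
          then have "integrable \<mu> (\<lambda>y. x * A (x * y))"
            using * by simp
          from inner_eq[OF this] show ?thesis
            by (simp add: mult.assoc)
        qed simp
      qed
    qed (use P.integrable_fst[OF intA] P.integrable_fst[OF intf] in \<open>auto dest: borel_measurable_integrable\<close>)
    also have "\<dots> = s * (\<integral>y. (\<integral>x. x * (x * A (x * y)) \<partial>N) \<partial>\<mu>)"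
      using P.integral_fst[OF intA] P.integral_snd[OF intA] by simp
    also have "(\<integral>y. (\<integral>x. x * (x * A (x * y)) \<partial>N) \<partial>\<mu>) = (\<integral>y. \<sigma>\<^sup>2 * (\<integral>x. B (x * y) \<partial>N) \<partial>\<mu>)"
      using P.AE_integrable_snd[OF intB] P.integrable_snd[OF intA] P.integrable_snd[OF intB]
      by (intro integral_cong_AE) (auto dest: borel_measurable_integrable elim!: eventually_mono intro: outer_eq)
    also have "\<dots> = \<sigma>\<^sup>2 * (\<integral>z. (case z of (x, y) \<Rightarrow> B (x * y)) \<partial>(N \<Otimes>\<^sub>M \<mu>))"
      using P.integral_snd[OF intB] by simp
    also have "(\<integral>z. (case z of (x, y) \<Rightarrow> B (x * y)) \<partial>(N \<Otimes>\<^sub>M \<mu>)) = (\<integral>y. B y \<partial>?D)"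
      by (simp add: integral_distr split_beta')
    finally show "(\<integral>y. y * f y \<partial>?D) = \<sigma>\<^sup>2 * s * (\<integral>y. euler_op (Suc n) f y \<partial>?D)"
      by (simp add: B_def)
  qed
qed

text \<open>The induction starts with one factor, as the recursion for \<open>euler_op\<close>
  starts at order one. A general index set lets a factor be split off without renumbering.\<close>

lemma mult_stein_prod_normal:
  fixes N :: "'b measure" and X :: "'i \<Rightarrow> 'b \<Rightarrow> real"
  assumes prob: "prob_space N" and J: "finite J" "J \<noteq> {}"
    and indep: "prob_space.indep_vars N (\<lambda>_. borel) X J"
    and \<sigma>: "\<And>k. k \<in> J \<Longrightarrow> \<sigma> k > 0"
    and X: "\<And>k. k \<in> J \<Longrightarrow> distributed N lborel (X k) (normal_density 0 (\<sigma> k))"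
  shows "mult_stein (card J) (\<Prod>k\<in>J. (\<sigma> k)\<^sup>2) (distr N borel (\<lambda>\<omega>. \<Prod>k\<in>J. X k \<omega>))"
  using J indep \<sigma> X
proof (induction J rule: finite_ne_induct)
  have law: "distr N borel (X k) = density lborel (\<lambda>x. ennreal (normal_density 0 (\<sigma> k) x))"
    if "distributed N lborel (X k) (normal_density 0 (\<sigma> k))" for k
    using distributed_distr_eq_density[OF that] by (simp cong: distr_cong)
  interpret prob_space N by fact
  case (singleton k)
  have "distributed N lborel (X k) (normal_density 0 (\<sigma> k))" "\<sigma> k > 0"
    using singleton by auto
  then show ?case
    using mult_stein_normal[of "\<sigma> k"] by (simp add: law)
next
  have law: "distr N borel (X k) = density lborel (\<lambda>x. ennreal (normal_density 0 (\<sigma> k) x))"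
    if "distributed N lborel (X k) (normal_density 0 (\<sigma> k))" for k
    using distributed_distr_eq_density[OF that] by (simp cong: distr_cong)
  interpret prob_space N by fact
  case (insert k J)
  define Z where "Z = (\<lambda>\<omega>. \<Prod>k\<in>J. X k \<omega>)"
  have k: "distributed N lborel (X k) (normal_density 0 (\<sigma> k))" "\<sigma> k > 0"
    using insert.prems by auto
  have iv: "indep_var borel (X k) borel Z"
    unfolding Z_def using insert by (intro indep_vars_prod) auto
  have [measurable]: "random_variable borel (X k)" "random_variable borel Z"
    using indep_var_rv1[OF iv] indep_var_rv2[OF iv] by auto
  have J: "indep_vars (\<lambda>_. borel) X J"
    using insert.prems(1) by (rule indep_vars_subset) auto
  have IH: "mult_stein (card J) (\<Prod>k\<in>J. (\<sigma> k)\<^sup>2) (distr N borel Z)"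
    unfolding Z_def using insert.prems J by (intro insert.IH) auto
  have "mult_stein (Suc (card J)) ((\<sigma> k)\<^sup>2 * (\<Prod>k\<in>J. (\<sigma> k)\<^sup>2))
      (distr (distr N borel (X k) \<Otimes>\<^sub>M distr N borel Z) borel (\<lambda>(x, y). x * y))"
    unfolding law[OF k(1)] using insert.hyps k(2)
    by (intro mult_stein_mult IH prob_space_distr prod_nonneg) (auto simp: card_gt_0_iff)
  also have "distr (distr N borel (X k) \<Otimes>\<^sub>M distr N borel Z) borel (\<lambda>(x, y). x * y) =
      distr N borel (\<lambda>\<omega>. X k \<omega> * Z \<omega>)"
    using iv unfolding indep_var_distribution_eq by (auto simp: distr_distr comp_def)
  finally show ?case
    using insert.hyps by (simp add: Z_def)
qed

lemma integrable_abs_power_prod_normal: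
  fixes N :: "'b measure" and X :: "'i \<Rightarrow> 'b \<Rightarrow> real"
  assumes prob: "prob_space N" and J: "finite J"
    and indep: "prob_space.indep_vars N (\<lambda>_. borel) X J"
    and \<sigma>: "\<And>k. k \<in> J \<Longrightarrow> \<sigma> k > 0"
    and X: "\<And>k. k \<in> J \<Longrightarrow> distributed N lborel (X k) (normal_density 0 (\<sigma> k))"
  shows "integrable N (\<lambda>\<omega>. \<bar>\<Prod>k\<in>J. X k \<omega>\<bar> ^ n)"
proof -
  interpret prob_space N by fact
  have "integrable N (\<lambda>\<omega>. \<Prod>k\<in>J. \<bar>X k \<omega>\<bar> ^ n)"
  proof (rule indep_vars_integrable[OF J])
    show "indep_vars (\<lambda>_. borel) (\<lambda>k \<omega>. \<bar>X k \<omega>\<bar> ^ n) J"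
      by (rule indep_vars_compose2[OF indep]) auto
    show "integrable N (\<lambda>\<omega>. \<bar>X k \<omega>\<bar> ^ n)" if "k \<in> J" for k
      using integrable_normal_moment_abs[OF \<sigma>[OF that], of 0 n]
      by (subst distributed_integrable[OF X[OF that], symmetric]) auto
  qed
  then show ?thesis
    by (simp add: abs_prod prod_power_distrib)
qed

lemma expectation_prod_normal:
  fixes N :: "'b measure" and X :: "'i \<Rightarrow> 'b \<Rightarrow> real"
  assumes prob: "prob_space N" and J: "finite J" "J \<noteq> {}"
    and indep: "prob_space.indep_vars N (\<lambda>_. borel) X J"
    and \<sigma>: "\<And>k. k \<in> J \<Longrightarrow> \<sigma> k > 0"
    and X: "\<And>k. k \<in> J \<Longrightarrow> distributed N lborel (X k) (normal_density 0 (\<sigma> k))"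
  shows "(\<integral>\<omega>. (\<Prod>k\<in>J. X k \<omega>) \<partial>N) = 0"
proof -
  interpret prob_space N by fact
  have "(\<integral>\<omega>. (\<Prod>k\<in>J. X k \<omega>) \<partial>N) = (\<Prod>k\<in>J. \<integral>\<omega>. X k \<omega> \<partial>N)"
  proof (rule indep_vars_lebesgue_integral[OF J(1) indep])
    show "integrable N (X k)" if "k \<in> J" for k
      using integrable_normal_moment[OF \<sigma>[OF that], of 0 1]
      by (subst distributed_integrable[OF X[OF that], symmetric]) auto
  qed
  also have "\<dots> = (\<Prod>k\<in>J. 0)"
    using normal_distributed_expectation[OF \<sigma> X] by (intro prod.cong) auto
  finally show ?thesis
    using J by (simp add: card_gt_0_iff)
qed

lemma PN_op_measurable:
  assumes "continuously_differentiable p f"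
  shows "PN_op p s2 f \<in> borel_measurable borel"
proof -
  have [measurable]: "euler_op p f \<in> borel_measurable borel" "f \<in> borel_measurable borel"
    using euler_op_measurable[OF assms] continuously_differentiable_measurable[OF assms, of 0] by auto
  show ?thesis
    unfolding PN_op_eq_euler_op [abs_def] by measurable
qed

text \<open>The identity is applied to f - f(0), and the remaining term f(0) Y has mean zero.
  Integrability of Y (f(Y) - f(0)) follows from the bound in \<open>mult_stein\<close>.\<close>

lemma PN_op_integral_eq_0:
  assumes "prob_space N" and p: "p \<ge> 1" and s2: "s2 > 0" and [measurable]: "Y \<in> borel_measurable N"
    and stein: "mult_stein p s2 (distr N borel Y)"
    and Y: "integrable N Y" "integral\<^sup>L N Y = 0"
    and f: "f \<in> stein_class p (PN_coeff p s2) N Y"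
  shows "integrable N (\<lambda>\<omega>. PN_op p s2 f (Y \<omega>))" and "(\<integral>\<omega>. PN_op p s2 f (Y \<omega>) \<partial>N) = 0"
proof -
  interpret prob_space N by fact
  have cd: "continuously_differentiable p f"
    and int: "\<And>t j. t \<le> p \<Longrightarrow> j \<le> max_coeff_degree p (PN_coeff p s2) \<Longrightarrow>
        integrable N (\<lambda>\<omega>. \<bar>Y \<omega> ^ j * (deriv ^^ t) f (Y \<omega>)\<bar>)"
    using f by (auto simp: stein_class_def)
  \<comment> \<open>\<open>Stirling p p = 1\<close> and s2 > 0 keep the leading coefficient nonzero,
    so the class controls Y^k f^(t)(Y) for all k < p.\<close>
  have deg: "p - 1 \<le> max_coeff_degree p (PN_coeff p s2)"
  proof -
    have "degree (PN_coeff p s2 p) = p - 1"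
      using p s2 by (simp add: PN_coeff_def degree_monom_eq)
    then show ?thesis
      unfolding max_coeff_degree_def by (metis Max_ge atMost_iff finite_atMost finite_imageI imageI order_refl)
  qed
  have meas: "(deriv ^^ t) f \<in> borel_measurable borel" if "t \<le> p" for t
    using continuously_differentiable_measurable[OF cd that] .
  have [measurable]: "f \<in> borel_measurable borel" "euler_op p f \<in> borel_measurable borel"
    using meas[of 0] euler_op_measurable[OF cd] by auto
  have int_E: "integrable N (\<lambda>\<omega>. euler_op p f (Y \<omega>))"
    unfolding euler_op_def mult.assoc
  proof (intro Bochner_Integration.integrable_sum integrable_mult_right)
    fix k assume k: "k \<in> {..<p}"
    then have [measurable]: "(deriv ^^ Suc k) f \<in> borel_measurable borel"
      by (intro meas) auto
    have "integrable N (\<lambda>\<omega>. \<bar>Y \<omega> ^ k * (deriv ^^ Suc k) f (Y \<omega>)\<bar>)"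
      using k deg by (intro int) auto
    then show "integrable N (\<lambda>\<omega>. Y \<omega> ^ k * (deriv ^^ Suc k) f (Y \<omega>))"
      by (subst (asm) integrable_abs_iff) (simp_all del: funpow.simps)
  qed
  define g where "g y = f y - f 0" for y
  have g: "continuously_differentiable p g" "g 0 = 0" "euler_op p g = euler_op p f"
    using continuously_differentiable_diff_const[OF cd] euler_op_diff_const[OF cd]
    by (auto simp: g_def [abs_def])
  have [measurable]: "g \<in> borel_measurable borel"
    unfolding g_def by measurable
  have "(\<integral>\<^sup>+y. ennreal \<bar>y * g y\<bar> \<partial>distr N borel Y) \<le> ennreal s2 * (\<integral>\<^sup>+y. ennreal \<bar>euler_op p f y\<bar> \<partial>distr N borel Y)"
    using stein g unfolding mult_stein_def by (metis g(3))
  also have "\<dots> < \<infinity>"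
    using int_E by (simp add: nn_integral_distr integrable_iff_bounded ennreal_mult_less_top)
  finally have int_g: "integrable N (\<lambda>\<omega>. Y \<omega> * g (Y \<omega>))"
    by (simp add: nn_integral_distr integrable_iff_bounded)
  have "integrable (distr N borel Y) (euler_op p f)"
    using int_E by (simp add: integrable_distr_eq)
  then have "(\<integral>y. y * g y \<partial>distr N borel Y) = s2 * (\<integral>y. euler_op p f y \<partial>distr N borel Y)"
    using stein g unfolding mult_stein_def by (metis g(3))
  then have eq: "(\<integral>\<omega>. Y \<omega> * g (Y \<omega>) \<partial>N) = s2 * (\<integral>\<omega>. euler_op p f (Y \<omega>) \<partial>N)"
    by (simp add: integral_distr)
  have decomp: "PN_op p s2 f y = s2 * euler_op p f y - y * g y - f 0 * y" for y
    by (simp add: PN_op_eq_euler_op g_def algebra_simps)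
  show "integrable N (\<lambda>\<omega>. PN_op p s2 f (Y \<omega>))"
    unfolding decomp using int_E int_g Y by auto
  show "(\<integral>\<omega>. PN_op p s2 f (Y \<omega>) \<partial>N) = 0"
    unfolding decomp using int_E int_g Y eq by simp
qed

lemma stein_class_polynomial_growth:
  assumes "prob_space N" and [measurable]: "Y \<in> borel_measurable N"
    and moments: "\<And>n. integrable N (\<lambda>\<omega>. \<bar>Y \<omega>\<bar> ^ n)"
    and f: "continuously_differentiable T f"
    and growth: "\<And>t. t \<le> T \<Longrightarrow> \<exists>C m. \<forall>y. \<bar>(deriv ^^ t) f y\<bar> \<le> C * (1 + \<bar>y\<bar> ^ m)"
  shows "f \<in> stein_class T c N Y"
proof -
  have "integrable N (\<lambda>\<omega>. \<bar>Y \<omega> ^ j * (deriv ^^ t) f (Y \<omega>)\<bar>)" if t: "t \<le> T" for t j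
  proof -
    obtain C m where C: "\<And>y. \<bar>(deriv ^^ t) f y\<bar> \<le> C * (1 + \<bar>y\<bar> ^ m)"
      using growth[OF t] by blast
    have [measurable]: "(deriv ^^ t) f \<in> borel_measurable borel"
      by (rule continuously_differentiable_measurable[OF f t])
    have "integrable N (\<lambda>\<omega>. C * (\<bar>Y \<omega>\<bar> ^ j + \<bar>Y \<omega>\<bar> ^ (j + m)))"
      by (intro integrable_mult_right Bochner_Integration.integrable_add moments)
    then show ?thesis
    proof (rule Bochner_Integration.integrable_bound)
      show "AE \<omega> in N. norm \<bar>Y \<omega> ^ j * (deriv ^^ t) f (Y \<omega>)\<bar> \<le> norm (C * (\<bar>Y \<omega>\<bar> ^ j + \<bar>Y \<omega>\<bar> ^ (j + m)))"
      proof (rule AE_I2)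
        fix \<omega>
        have "\<bar>Y \<omega> ^ j * (deriv ^^ t) f (Y \<omega>)\<bar> \<le> \<bar>Y \<omega>\<bar> ^ j * (C * (1 + \<bar>Y \<omega>\<bar> ^ m))"
          unfolding abs_mult power_abs by (intro mult_left_mono C) auto
        also have "\<dots> = C * (\<bar>Y \<omega>\<bar> ^ j + \<bar>Y \<omega>\<bar> ^ (j + m))"
          by (simp add: algebra_simps power_add)
        finally show "norm \<bar>Y \<omega> ^ j * (deriv ^^ t) f (Y \<omega>)\<bar> \<le> norm (C * (\<bar>Y \<omega>\<bar> ^ j + \<bar>Y \<omega>\<bar> ^ (j + m)))"
          by simp
      qed
    qed simp
  qed
  then show ?thesis
    using f by (simp add: stein_class_def)
qed

subsection \<open>Test functions and uniqueness\<close>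

lemma const_derivatives:
  "continuously_differentiable n (\<lambda>_. c)" "(deriv ^^ t) (\<lambda>_::real. c::real) = (\<lambda>_. if t = 0 then c else 0)"
proof -
  define h where "h = (\<lambda>t (_::real). if t = (0::nat) then c else (0::real))"
  have *: "h 0 = (\<lambda>_. c)" "continuous_on UNIV (h n)" "(h t has_real_derivative h (Suc t) x) (at x)" for n t x
    by (auto simp: h_def intro!: derivative_eq_intros)
  show "continuously_differentiable n (\<lambda>_. c)"
    by (rule continuously_differentiableI[where h = h, OF *(1,3,2)])
  show "(deriv ^^ t) (\<lambda>_::real. c) = (\<lambda>_. if t = 0 then c else 0)"
    using iterated_deriv_eqI[where h = h and n = t, OF *(1,3,2) order_refl] by (simp only: h_def)
qed

lemma ident_derivatives:
  "continuously_differentiable n (\<lambda>y. y)"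
  "(deriv ^^ t) (\<lambda>y::real. y) = (\<lambda>y. if t = 0 then y else if t = 1 then 1 else 0)"
proof -
  define h where "h = (\<lambda>t (y::real). if t = (0::nat) then y else if t = 1 then 1 else (0::real))"
  have *: "h 0 = (\<lambda>y. y)" "continuous_on UNIV (h n)" "(h t has_real_derivative h (Suc t) x) (at x)" for n t x
    by (cases "n = 0"; auto simp: h_def intro!: derivative_eq_intros)+
  show "continuously_differentiable n (\<lambda>y. y)"
    by (rule continuously_differentiableI[where h = h, OF *(1,3,2)])
  show "(deriv ^^ t) (\<lambda>y::real. y) = (\<lambda>y. if t = 0 then y else if t = 1 then 1 else 0)"
    using iterated_deriv_eqI[where h = h and n = t, OF *(1,3,2) order_refl] by (simp only: h_def)
qed

lemma pos_powr_polynomial_growth: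
  assumes "r \<ge> 0"
  obtains m where "\<And>y. pos_powr r y \<le> 1 + \<bar>y\<bar> ^ m"
proof (rule that[of "nat \<lceil>r\<rceil>"])
  fix y
  have "r \<le> real (nat \<lceil>r\<rceil>)"
    by (rule real_nat_ceiling_ge)
  then have "pos_powr r y \<le> 1 + pos_powr (real (nat \<lceil>r\<rceil>)) y"
    using assms by (rule pos_powr_mono_exponent[rotated])
  also have "pos_powr (real (nat \<lceil>r\<rceil>)) y \<le> \<bar>y\<bar> ^ nat \<lceil>r\<rceil>"
    by (auto simp: pos_powr_def powr_realpow)
  finally show "pos_powr r y \<le> 1 + \<bar>y\<bar> ^ nat \<lceil>r\<rceil>"
    by simp
qed

text \<open>All that uniqueness uses of the Stein class. The two families of truncated powers
  examine the half-lines separately; the first two functions link them.\<close>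

definition stein_tests :: "nat \<Rightarrow> (real \<Rightarrow> real) set" where
  "stein_tests p = {\<lambda>_. 1, \<lambda>y. y} \<union> (\<Union>s\<in>{real p<..}. {pos_powr s, \<lambda>y. pos_powr s (- y)})"

lemma continuously_differentiable_stein_tests:
  assumes "f \<in> stein_tests p"
  shows "continuously_differentiable p f"
  using assms const_derivatives(1) ident_derivatives(1) continuously_differentiable_pos_powr
    continuously_differentiable_dilation[OF continuously_differentiable_pos_powr, of p _ "-1"]
  by (auto simp: stein_tests_def)

lemma stein_tests_subset_stein_class:
  assumes "prob_space N" and "Y \<in> borel_measurable N"
    and "\<And>n. integrable N (\<lambda>\<omega>. \<bar>Y \<omega>\<bar> ^ n)"
  shows "stein_tests p \<subseteq> stein_class p c N Y"
proof
  fix f assume f: "f \<in> stein_tests p"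
  have growth_powr: "\<exists>C m. \<forall>y. \<bar>(deriv ^^ t) (\<lambda>y. pos_powr s (r * y)) y\<bar> \<le> C * (1 + \<bar>y\<bar> ^ m)"
    if s: "s > real p" and t: "t \<le> p" and r: "\<bar>r\<bar> = 1" for s t r
  proof -
    obtain m where m: "\<And>y. pos_powr (s - real t) y \<le> 1 + \<bar>y\<bar> ^ m"
      using pos_powr_polynomial_growth[of "s - real t"] s t by auto
    have "\<bar>(deriv ^^ t) (\<lambda>y. pos_powr s (r * y)) y\<bar> =
        \<bar>\<Prod>i<t. s - real i\<bar> * pos_powr (s - real t) (r * y)" for y
      using pos_powr_nonneg r
      by (simp add: iterated_deriv_dilation[OF continuously_differentiable_pos_powr[OF s] t]
          iterated_deriv_pos_powr[OF s t] abs_mult power_abs)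
    also have "\<dots> y \<le> \<bar>\<Prod>i<t. s - real i\<bar> * (1 + \<bar>r * y\<bar> ^ m)" for y
      by (intro mult_left_mono m) auto
    finally show ?thesis
      using r by (auto simp: abs_mult)
  qed
  have growth: "\<exists>C m. \<forall>y. \<bar>(deriv ^^ t) f y\<bar> \<le> C * (1 + \<bar>y\<bar> ^ m)" if t: "t \<le> p" for t
  proof -
    consider "f = (\<lambda>_. 1)" | "f = (\<lambda>y. y)" | s where "s > real p" "f = (\<lambda>y. pos_powr s (1 * y))"
      | s where "s > real p" "f = (\<lambda>y. pos_powr s ((-1) * y))"
      using f by (auto simp: stein_tests_def)
    then show ?thesis
    proof cases
      case 1
      show ?thesis
        unfolding 1 const_derivatives by (rule exI[of _ 1], rule exI[of _ 0]) auto
    next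
      case 2
      show ?thesis
        unfolding 2 ident_derivatives by (rule exI[of _ 1], rule exI[of _ 1]) auto
    next
      case 3
      then show ?thesis
        using growth_powr[of s t 1] t by simp
    next
      case 4
      then show ?thesis
        using growth_powr[of s t "-1"] t by simp
    qed
  qed
  show "f \<in> stein_class p c N Y"
    by (rule stein_class_polynomial_growth[OF assms continuously_differentiable_stein_tests[OF f] growth])
qed

text \<open>One formula for every test function: eigenvalue 0 for the constant, 1 for the identity,
  s for a truncated power and its reflection.\<close>

lemma PN_op_homogeneous:
  assumes "p \<ge> 1" "continuously_differentiable p f" "\<And>y. y * deriv f y = s * f y"
  shows "PN_op p s2 f y = s2 * s ^ (p - 1) * deriv f y - y * f y"
  using euler_op_homogeneous[of "p - 1" f s y] assms by (simp add: PN_op_eq_euler_op)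

lemma PN_op_const: "p \<ge> 1 \<Longrightarrow> PN_op p s2 (\<lambda>_. 1) y = - y"
  by (subst PN_op_homogeneous[where s = 0]) (auto simp: const_derivatives)

lemma PN_op_ident: "p \<ge> 1 \<Longrightarrow> PN_op p s2 (\<lambda>y. y) y = s2 - y\<^sup>2"
  by (subst PN_op_homogeneous[where s = 1]) (auto simp: ident_derivatives power2_eq_square)

lemma mult_pos_powr: "y * pos_powr s y = pos_powr (s + 1) y"
  by (auto simp: pos_powr_def powr_add)

lemma PN_op_pos_powr:
  assumes p: "p \<ge> 1" and s: "s > real p"
  shows "PN_op p s2 (pos_powr s) y = s2 * s ^ p * pos_powr (s - 1) y - pos_powr (s + 1) y"
    and "PN_op p s2 (\<lambda>y. pos_powr s (- y)) y = - (s2 * s ^ p * pos_powr (s - 1) (- y) - pos_powr (s + 1) (- y))"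
proof -
  have s1: "s > 1"
    using p s by linarith
  have pw: "s ^ (p - 1) * s = s ^ p"
    using p by (cases p) auto
  have d: "deriv (pos_powr s) = (\<lambda>y. s * pos_powr (s - 1) y)"
    using DERIV_imp_deriv[OF has_real_derivative_pos_powr[OF s1]] by auto
  have "PN_op p s2 (pos_powr s) y = s2 * s ^ (p - 1) * deriv (pos_powr s) y - y * pos_powr s y"
    by (intro PN_op_homogeneous p continuously_differentiable_pos_powr s)
       (use mult_pos_powr[of _ "s - 1"] in \<open>simp add: d mult.left_commute\<close>)
  then show "PN_op p s2 (pos_powr s) y = s2 * s ^ p * pos_powr (s - 1) y - pos_powr (s + 1) y"
    by (simp add: d mult_pos_powr flip: pw)
  have d': "deriv (\<lambda>y. pos_powr s (- y)) = (\<lambda>y. - (s * pos_powr (s - 1) (- y)))"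
  proof
    fix y
    have "((\<lambda>y. pos_powr s (- y)) has_real_derivative s * pos_powr (s - 1) (- y) * (- 1)) (at y)"
      by (rule DERIV_chain2[where f = "pos_powr s" and g = uminus, OF has_real_derivative_pos_powr[OF s1]])
         (auto intro!: derivative_eq_intros)
    from DERIV_imp_deriv[OF this] show "deriv (\<lambda>y. pos_powr s (- y)) y = - (s * pos_powr (s - 1) (- y))"
      by simp
  qed
  have neg: "y * pos_powr r (- y) = - pos_powr (r + 1) (- y)" for y r
    using mult_pos_powr[of "- y" r] by simp
  have "PN_op p s2 (\<lambda>y. pos_powr s (- y)) y =
      s2 * s ^ (p - 1) * deriv (\<lambda>y. pos_powr s (- y)) y - y * pos_powr s (- y)"
  proof (intro PN_op_homogeneous p)
    show "continuously_differentiable p (\<lambda>y. pos_powr s (- y))"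
      using s by (intro continuously_differentiable_stein_tests) (auto simp: stein_tests_def)
    show "y * deriv (\<lambda>y. pos_powr s (- y)) y = s * pos_powr s (- y)" for y
      using neg[of y "s - 1"] by (simp add: d' mult.left_commute)
  qed
  then show "PN_op p s2 (\<lambda>y. pos_powr s (- y)) y =
      - (s2 * s ^ p * pos_powr (s - 1) (- y) - pos_powr (s + 1) (- y))"
    by (simp add: d' neg flip: pw)
qed

section \<open>Joining the two half-lines\<close>

lemma reflect_law:
  fixes Q :: "real measure" and g :: "real \<Rightarrow> real" and h :: "real \<Rightarrow> ennreal"
  assumes Q: "sets Q = sets borel"
  shows integrable_reflect: "g \<in> borel_measurable borel \<Longrightarrow>
      integrable (distr Q borel uminus) g \<longleftrightarrow> integrable Q (\<lambda>y. g (- y))"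
    and integral_reflect: "g \<in> borel_measurable borel \<Longrightarrow>
      (\<integral>y. g y \<partial>distr Q borel uminus) = (\<integral>y. g (- y) \<partial>Q)"
    and nn_integral_reflect: "h \<in> borel_measurable borel \<Longrightarrow>
      (\<integral>\<^sup>+y. h y * indicator {0<..} y \<partial>distr Q borel uminus) = (\<integral>\<^sup>+y. h (- y) * indicator {..<0} y \<partial>Q)"
proof -
  have um: "uminus \<in> measurable Q borel"
    by (simp add: measurable_cong_sets[OF Q refl])
  show "integrable (distr Q borel uminus) g \<longleftrightarrow> integrable Q (\<lambda>y. g (- y))"
    "(\<integral>y. g y \<partial>distr Q borel uminus) = (\<integral>y. g (- y) \<partial>Q)" if "g \<in> borel_measurable borel"
    using that by (rule integrable_distr_eq[OF um] integral_distr[OF um])+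
  show "(\<integral>\<^sup>+y. h y * indicator {0<..} y \<partial>distr Q borel uminus) = (\<integral>\<^sup>+y. h (- y) * indicator {..<0} y \<partial>Q)"
    if [measurable]: "h \<in> borel_measurable borel"
  proof -
    have "(\<integral>\<^sup>+y. h y * indicator {0<..} y \<partial>distr Q borel uminus) =
        (\<integral>\<^sup>+y. h (- y) * indicator {0<..} (- y) \<partial>Q)"
      by (rule nn_integral_distr[OF um]) measurable
    also have "\<dots> = (\<integral>\<^sup>+y. h (- y) * indicator {..<0} y \<partial>Q)"
      by (intro nn_integral_cong) (simp add: indicator_def)
    finally show ?thesis .
  qed
qed

text \<open>A centred law without positive mass sits at 0 and has second moment 0. This supplies the
  nonzero reference measure that the proportionality argument needs.\<close>

lemma emeasure_positive_neq_0:
  fixes Q :: "real measure"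
  assumes sets_Q [measurable_cong]: "sets Q = sets borel"
    and int: "integrable Q (\<lambda>y. y)" and mean: "(\<integral>y. y \<partial>Q) = 0" and var: "(\<integral>y. y\<^sup>2 \<partial>Q) \<noteq> 0"
  shows "emeasure Q {0<..} \<noteq> 0"
proof
  assume "emeasure Q {0<..} = 0"
  then have "AE y in Q. y \<notin> {0<..}"
    by (intro AE_not_in) (simp add: null_sets_def sets_Q)
  then have nonneg: "AE y in Q. 0 \<le> - y"
    by eventually_elim auto
  have "AE y in Q. - y = 0"
    using integral_nonneg_eq_0_iff_AE[OF integrable_minus[OF int] nonneg] mean by simp
  then have "(\<integral>y. y\<^sup>2 \<partial>Q) = (\<integral>y. 0 \<partial>Q)"
    by (intro integral_cong_AE) auto
  then show False
    using var by simp
qed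

lemma emeasure_reflect_positive_neq_0:
  fixes Q :: "real measure"
  assumes Q: "sets Q = sets borel"
    and "integrable Q (\<lambda>y. y)" and "(\<integral>y. y \<partial>Q) = 0" and "(\<integral>y. y\<^sup>2 \<partial>Q) \<noteq> 0"
  shows "emeasure (distr Q borel uminus) {0<..} \<noteq> 0"
proof (rule emeasure_positive_neq_0)
  have meas: "(\<lambda>y. y) \<in> borel_measurable borel" "(\<lambda>y. y\<^sup>2) \<in> borel_measurable (borel :: real measure)"
    by measurable
  show "integrable (distr Q borel uminus) (\<lambda>y. y)"
    using assms(2) by (simp add: integrable_reflect[OF Q meas(1)])
  show "(\<integral>y. y \<partial>distr Q borel uminus) = 0"
    using assms(3) by (simp add: integral_reflect[OF Q meas(1)])
  show "(\<integral>y. y\<^sup>2 \<partial>distr Q borel uminus) \<noteq> 0"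
    using assms(4) by (simp add: integral_reflect[OF Q meas(2)])
qed simp

lemma nn_integral_positive_negative:
  fixes Q :: "real measure" and g :: "real \<Rightarrow> ennreal"
  assumes sets_Q [measurable_cong]: "sets Q = sets borel"
    and [measurable]: "g \<in> borel_measurable borel" and g0: "g 0 = 0"
  shows "(\<integral>\<^sup>+y. g y \<partial>Q) = (\<integral>\<^sup>+y. g y * indicator {0<..} y \<partial>Q) + (\<integral>\<^sup>+y. g y * indicator {..<0} y \<partial>Q)"
proof -
  have "g y = g y * indicator {0<..} y + g y * indicator {..<0} y" for y
    using g0 by (cases y "0::real" rule: linorder_cases) auto
  then have "(\<integral>\<^sup>+y. g y \<partial>Q) = (\<integral>\<^sup>+y. g y * indicator {0<..} y + g y * indicator {..<0} y \<partial>Q)"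
    by simp
  also have "\<dots> = (\<integral>\<^sup>+y. g y * indicator {0<..} y \<partial>Q) + (\<integral>\<^sup>+y. g y * indicator {..<0} y \<partial>Q)"
    by (rule nn_integral_add) auto
  finally show ?thesis .
qed

text \<open>Symmetric in the two laws, so nothing about products of normal variables enters. Each
  half-line yields an unknown factor; the mean equates the factors, the second moment fixes their
  value, and the total mass settles the origin.\<close>

lemma stein_equation_unique:
  fixes \<mu> \<nu> :: "real measure"
  assumes prob: "prob_space \<mu>" "prob_space \<nu>"
    and sets_borel: "sets \<mu> = sets borel" "sets \<nu> = sets borel"
    and p: "p \<ge> 1" and s2: "s2 > 0"
    and stein: "\<And>Q f. Q \<in> {\<mu>, \<nu>} \<Longrightarrow> f \<in> stein_tests p \<Longrightarrow>
        integrable Q (PN_op p s2 f) \<and> (\<integral>y. PN_op p s2 f y \<partial>Q) = 0"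
  shows "\<mu> = \<nu>"
proof -
  have Q_sets: "sets Q = sets borel" and Q_prob: "prob_space Q" if "Q \<in> {\<mu>, \<nu>}" for Q
    using that prob sets_borel by auto
  have [measurable_cong]: "sets \<mu> = sets borel" "sets \<nu> = sets borel"
    by fact+
  have mean: "integrable Q (\<lambda>y. y)" "(\<integral>y. y \<partial>Q) = 0" if "Q \<in> {\<mu>, \<nu>}" for Q
    using stein[OF that, of "\<lambda>_. 1"] by (auto simp: stein_tests_def PN_op_const[OF p, abs_def])
  have var: "integrable Q (\<lambda>y. y\<^sup>2)" "(\<integral>y. y\<^sup>2 \<partial>Q) = s2" if Q: "Q \<in> {\<mu>, \<nu>}" for Q
  proof -
    interpret prob_space Q
      by (rule Q_prob[OF Q])
    have *: "integrable Q (\<lambda>y. s2 - y\<^sup>2)" "(\<integral>y. s2 - y\<^sup>2 \<partial>Q) = 0"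
      using stein[OF Q, of "\<lambda>y. y"] by (auto simp: stein_tests_def PN_op_ident[OF p, abs_def])
    have "integrable Q (\<lambda>y. s2 - (s2 - y\<^sup>2))"
      by (rule Bochner_Integration.integrable_diff[OF _ *(1)]) simp
    then show "integrable Q (\<lambda>y. y\<^sup>2)"
      by simp
    then show "(\<integral>y. y\<^sup>2 \<partial>Q) = s2"
      using *(2) by (simp add: prob_space)
  qed
  let ?R = "\<lambda>Q :: real measure. distr Q borel uminus"
  have pos: "emeasure \<nu> {0<..} \<noteq> 0"
    using var(2)[of \<nu>] s2 by (intro emeasure_positive_neq_0 sets_borel mean) auto
  have neg: "emeasure (?R \<nu>) {0<..} \<noteq> 0"
    using var(2)[of \<nu>] s2 by (intro emeasure_reflect_positive_neq_0 sets_borel mean) auto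
  have d_eq: "integrable Q (\<lambda>y. s2 * s ^ p * pos_powr (s - 1) y - pos_powr (s + 1) y) \<and>
      (\<integral>y. s2 * s ^ p * pos_powr (s - 1) y - pos_powr (s + 1) y \<partial>Q) = 0"
    if "Q \<in> {\<mu>, \<nu>}" and s: "s > real p" "s > 1" for Q s
  proof -
    have "pos_powr s \<in> stein_tests p"
      using s by (auto simp: stein_tests_def)
    from stein[OF that(1) this] show ?thesis
      unfolding PN_op_pos_powr(1)[OF p s(1), abs_def] .
  qed
  obtain d where d: "\<And>g :: real \<Rightarrow> ennreal. g \<in> borel_measurable borel \<Longrightarrow>
      (\<integral>\<^sup>+y. g y * indicator {0<..} y \<partial>\<mu>) = ennreal d * (\<integral>\<^sup>+y. g y * indicator {0<..} y \<partial>\<nu>)"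
    using positive_half_proportional[OF prob sets_borel s2 d_eq pos] by blast
  have R_prob: "prob_space (?R \<mu>)" "prob_space (?R \<nu>)" "sets (?R \<mu>) = sets borel" "sets (?R \<nu>) = sets borel"
    using prob by (auto intro!: prob_space.prob_space_distr)
  have e_eq: "integrable Q (\<lambda>y. s2 * s ^ p * pos_powr (s - 1) y - pos_powr (s + 1) y) \<and>
      (\<integral>y. s2 * s ^ p * pos_powr (s - 1) y - pos_powr (s + 1) y \<partial>Q) = 0"
    if Q: "Q \<in> {?R \<mu>, ?R \<nu>}" and s: "s > real p" "s > 1" for Q s
  proof -
    obtain Q' where Q': "Q' \<in> {\<mu>, \<nu>}" "Q = ?R Q'"
      using Q by auto
    let ?g = "\<lambda>y. s2 * s ^ p * pos_powr (s - 1) y - pos_powr (s + 1) y"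
    have g: "?g \<in> borel_measurable borel"
      by measurable
    \<comment> \<open>Up to sign, the reflected test function gives for \<open>Q'\<close> the
      equation that the truncated power would give for its reflection.\<close>
    have "(\<lambda>y. pos_powr s (- y)) \<in> stein_tests p"
      using s by (auto simp: stein_tests_def)
    from stein[OF Q'(1) this] have *: "integrable Q' (\<lambda>y. - ?g (- y))" "(\<integral>y. - ?g (- y) \<partial>Q') = 0"
      unfolding PN_op_pos_powr(2)[OF p s(1), abs_def] by simp_all
    have "integrable Q' (\<lambda>y. ?g (- y)) \<and> (\<integral>y. ?g (- y) \<partial>Q') = 0"
      using integrable_minus[OF *(1)] *(2) by (simp only: integral_minus neg_equal_0_iff_equal minus_minus)
    then show ?thesis
      unfolding Q'(2) integrable_reflect[OF Q_sets[OF Q'(1)] g] integral_reflect[OF Q_sets[OF Q'(1)] g] .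
  qed
  obtain e where e: "\<And>g :: real \<Rightarrow> ennreal. g \<in> borel_measurable borel \<Longrightarrow>
      (\<integral>\<^sup>+y. g y * indicator {0<..} y \<partial>?R \<mu>) = ennreal e * (\<integral>\<^sup>+y. g y * indicator {0<..} y \<partial>?R \<nu>)"
    using positive_half_proportional[OF R_prob s2 e_eq neg] by blast
  have e': "(\<integral>\<^sup>+y. g y * indicator {..<0} y \<partial>\<mu>) = ennreal e * (\<integral>\<^sup>+y. g y * indicator {..<0} y \<partial>\<nu>)"
    if [measurable]: "g \<in> borel_measurable borel" for g :: "real \<Rightarrow> ennreal"
  proof -
    have g: "(\<lambda>y. g (- y)) \<in> borel_measurable borel"
      by measurable
    show ?thesis
      using e[OF g] unfolding nn_integral_reflect[OF sets_borel(1) g] nn_integral_reflect[OF sets_borel(2) g]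
      by simp
  qed
  \<comment> \<open>The masses of the positive and negative parts of the identity. Zero mean makes
    them equal for each law; passing from \<nu> to \<mu> scales them by \<open>d\<close> and
    \<open>e\<close>, and since \<open>a \<nu>\<close> is finite and nonzero the factors
    coincide.\<close>
  define a where "a Q = (\<integral>\<^sup>+y. ennreal y \<partial>Q)" for Q :: "real measure"
  define b where "b Q = (\<integral>\<^sup>+y. ennreal (- y) \<partial>Q)" for Q :: "real measure"
  have ab: "a Q = b Q" "a Q < \<infinity>" if Q: "Q \<in> {\<mu>, \<nu>}" for Q
  proof -
    have fin: "a Q < \<infinity>" "b Q < \<infinity>"
      using mean(1)[OF Q] unfolding real_integrable_def a_def b_def by (auto simp: less_top)
    have "enn2real (a Q) = enn2real (b Q)"
      using real_lebesgue_integral_def[OF mean(1)[OF Q]] mean(2)[OF Q] by (simp add: a_def b_def)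
    moreover have "ennreal (enn2real (a Q)) = a Q" "ennreal (enn2real (b Q)) = b Q"
      using fin by (auto intro!: ennreal_enn2real)
    ultimately show "a Q = b Q"
      by metis
    show "a Q < \<infinity>"
      by (rule fin(1))
  qed
  have pos_part: "(\<integral>\<^sup>+y. ennreal y * indicator {0<..} y \<partial>Q) = a Q"
    and neg_part: "(\<integral>\<^sup>+y. ennreal (- y) * indicator {..<0} y \<partial>Q) = b Q" for Q
    unfolding a_def b_def by (auto intro!: nn_integral_cong split: split_indicator simp: ennreal_neg)
  have "a \<nu> \<noteq> 0"
  proof
    assume "a \<nu> = 0"
    then have "AE y in \<nu>. ennreal y = 0"
      unfolding a_def by (subst (asm) nn_integral_0_iff_AE) auto
    then have "AE y in \<nu>. y \<notin> {0<..}"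
      by eventually_elim (auto simp: ennreal_eq_0_iff)
    then show False
      using pos by (subst (asm) AE_iff_null_sets[symmetric]) (auto simp: sets_borel null_sets_def)
  qed
  moreover have "a \<nu> * ennreal d = a \<nu> * ennreal e"
  proof -
    have "a \<mu> = ennreal d * a \<nu>"
      using d[of ennreal] by (simp add: pos_part)
    moreover have "b \<mu> = ennreal e * b \<nu>"
      using e'[of "\<lambda>y. ennreal (- y)"] by (simp add: neg_part)
    moreover have "a \<mu> = b \<mu>" "a \<nu> = b \<nu>"
      by (rule ab(1); simp)+
    ultimately show ?thesis
      by (simp add: mult.commute)
  qed
  moreover have "a \<nu> < \<infinity>"
    by (rule ab(2)) simp
  ultimately have de: "ennreal d = ennreal e"
    unfolding ennreal_mult_cancel_left by auto
  have scaled: "(\<integral>\<^sup>+y. g y \<partial>\<mu>) = ennreal d * (\<integral>\<^sup>+y. g y \<partial>\<nu>)"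
    if [measurable]: "g \<in> borel_measurable borel" and "g 0 = 0" for g :: "real \<Rightarrow> ennreal"
    unfolding nn_integral_positive_negative[OF sets_borel(1) that] nn_integral_positive_negative[OF sets_borel(2) that]
      d[OF that(1)] e'[OF that(1)] de distrib_left ..
  have sq: "(\<integral>\<^sup>+y. ennreal (y\<^sup>2) \<partial>Q) = ennreal s2" if "Q \<in> {\<mu>, \<nu>}" for Q
    using var[OF that] by (subst nn_integral_eq_integral) auto
  have "ennreal s2 = ennreal d * ennreal s2"
    using scaled[of "\<lambda>y. ennreal (y\<^sup>2)"] sq[of \<mu>] sq[of \<nu>] by simp
  then have "ennreal s2 * 1 = ennreal s2 * ennreal d"
    by (simp add: mult.commute)
  then have "ennreal d = 1"
    unfolding ennreal_mult_cancel_left using s2 by auto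
  then have off_0: "emeasure \<mu> A = emeasure \<nu> A" if "A \<in> sets borel" "0 \<notin> A" for A
    using scaled[of "indicator A"] that by (simp add: sets_borel)
  show "\<mu> = \<nu>"
  proof (rule measure_eqI)
    fix A assume "A \<in> sets \<mu>"
    then have A [measurable]: "A \<in> sets borel"
      by (simp add: sets_borel)
    show "emeasure \<mu> A = emeasure \<nu> A"
    \<comment> \<open>The test integrals do not see the atom at 0. A set containing 0 is reached
      through its complement, both laws having total mass one.\<close>
    proof (cases "0 \<in> A")
      case True
      have compl: "emeasure Q (- A) = 1 - emeasure Q A" "emeasure Q A \<le> 1"
        if "prob_space Q" and Q: "sets Q = sets borel" for Q
      proof -
        interpret prob_space Q by fact
        have "space Q = UNIV"
          using sets_eq_imp_space_eq[OF Q] by simp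
        then show "emeasure Q (- A) = 1 - emeasure Q A" "emeasure Q A \<le> 1"
          using emeasure_compl[of A Q] Q A emeasure_space_1 emeasure_le_1[of A] by (auto simp: Compl_eq_Diff_UNIV)
      qed
      have "emeasure \<mu> (- A) = emeasure \<nu> (- A)"
        using True by (intro off_0) auto
      then have "1 - emeasure \<mu> A = 1 - emeasure \<nu> A"
        using compl(1)[OF prob(1) sets_borel(1)] compl(1)[OF prob(2) sets_borel(2)] by simp
      from ennreal_minus_cancel[OF _ compl(2)[OF prob(1) sets_borel(1)] compl(2)[OF prob(2) sets_borel(2)] this]
      show ?thesis
        by simp
    qed (simp add: off_0)
  qed (simp add: sets_borel)
qed

theorem proposition3p4:
  fixes p :: nat and \<sigma> :: "nat \<Rightarrow> real" and \<sigma>2 :: real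
    and N :: "'b measure" and X :: "nat \<Rightarrow> 'b \<Rightarrow> real" and Y :: "'b \<Rightarrow> real"
    and M :: "'a measure" and W :: "'a \<Rightarrow> real"
  assumes "p \<ge> 1"
    and "prob_space N"
    and "prob_space.indep_vars N (\<lambda>_. borel) X {1..p}"
    and "\<And>k. k \<in> {1..p} \<Longrightarrow> \<sigma> k > 0"
    and "\<And>k. k \<in> {1..p} \<Longrightarrow> distributed N lborel (X k) (normal_density 0 (\<sigma> k))"
    and "\<sigma>2 = (\<Prod>k\<in>{1..p}. (\<sigma> k)\<^sup>2)"
    and "Y = (\<lambda>\<omega>. \<Prod>k\<in>{1..p}. X k \<omega>)"
    and "prob_space M"
    and "W \<in> borel_measurable M"
  shows
    "(p \<in> {3, 4} \<and> integrable M (\<lambda>\<omega>. \<bar>W \<omega>\<bar> ^ (p - 1)) \<longrightarrow>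
        (distr M borel W = distr N borel Y \<longleftrightarrow>
         (\<forall>f \<in> stein_class p (PN_coeff p \<sigma>2) N Y.
            integrable M (\<lambda>\<omega>. PN_op p \<sigma>2 f (W \<omega>)) \<and>
            integral\<^sup>L M (\<lambda>\<omega>. PN_op p \<sigma>2 f (W \<omega>)) = 0)))
     \<and>
     (p \<in> {5, 6, 7, 8} \<and> distr M borel W = distr M borel (\<lambda>\<omega>. - W \<omega>) \<and>
      integrable M (\<lambda>\<omega>. \<bar>W \<omega>\<bar> ^ (p - 1)) \<longrightarrow>
        (distr M borel W = distr N borel Y \<longleftrightarrow>
         (\<forall>f \<in> stein_class p (PN_coeff p \<sigma>2) N Y.
            integrable M (\<lambda>\<omega>. PN_op p \<sigma>2 f (W \<omega>)) \<and>
            integral\<^sup>L M (\<lambda>\<omega>. PN_op p \<sigma>2 f (W \<omega>)) = 0)))"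
proof -
  note p = assms(1) and X = assms(2-5)
  let ?J = "{1..p}"
  have J: "finite ?J" "?J \<noteq> {}" "card ?J = p"
    using p by auto
  have s2: "\<sigma>2 > 0"
    unfolding assms(6) by (intro prod_pos zero_less_power assms(4))
  have W [measurable]: "W \<in> borel_measurable M"
    by fact
  have Y [measurable]: "Y \<in> borel_measurable N"
    unfolding assms(7) using assms(5) by (intro borel_measurable_prod) (simp add: distributed_def)
  have moments: "integrable N (\<lambda>\<omega>. \<bar>Y \<omega>\<bar> ^ n)" for n
    unfolding assms(7) by (rule integrable_abs_power_prod_normal[OF X(1) J(1) X(2-4)])
  have int_Y: "integrable N Y"
    using moments[of 1] by (simp add: integrable_abs_iff)
  have mean_Y: "integral\<^sup>L N Y = 0"
    unfolding assms(7) by (rule expectation_prod_normal[OF X(1) J(1,2) X(2-4)])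
  have stein_Y: "mult_stein p \<sigma>2 (distr N borel Y)"
    using mult_stein_prod_normal[OF X(1) J(1,2) X(2-4)] J(3) by (simp add: assms(6,7))
  note zero_Y = PN_op_integral_eq_0[OF X(1) p s2 Y stein_Y int_Y mean_Y]
  have cd: "continuously_differentiable p f" if "f \<in> stein_class p (PN_coeff p \<sigma>2) N Y" for f
    using that by (simp add: stein_class_def)
  \<comment> \<open>Moves the condition from the underlying space to the law of \<open>W\<close>,
    where uniqueness is formulated.\<close>
  have law_W: "(integrable M (\<lambda>\<omega>. PN_op p \<sigma>2 f (W \<omega>)) \<and> (\<integral>\<omega>. PN_op p \<sigma>2 f (W \<omega>) \<partial>M) = 0) \<longleftrightarrow>
      (integrable (distr M borel W) (PN_op p \<sigma>2 f) \<and> (\<integral>y. PN_op p \<sigma>2 f y \<partial>distr M borel W) = 0)"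
    if "continuously_differentiable p f" for f
    using PN_op_measurable[OF that] by (simp add: integrable_distr_eq integral_distr)
  have law_Y: "integrable (distr N borel Y) (PN_op p \<sigma>2 f) \<and> (\<integral>y. PN_op p \<sigma>2 f y \<partial>distr N borel Y) = 0"
    if "f \<in> stein_class p (PN_coeff p \<sigma>2) N Y" for f
    using PN_op_measurable[OF cd[OF that]] zero_Y[OF that] by (simp add: integrable_distr_eq integral_distr)
  have sub: "stein_tests p \<subseteq> stein_class p (PN_coeff p \<sigma>2) N Y"
    by (rule stein_tests_subset_stein_class[OF X(1) Y moments])
  have "distr M borel W = distr N borel Y \<longleftrightarrow>
         (\<forall>f \<in> stein_class p (PN_coeff p \<sigma>2) N Y.
            integrable M (\<lambda>\<omega>. PN_op p \<sigma>2 f (W \<omega>)) \<and>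
            integral\<^sup>L M (\<lambda>\<omega>. PN_op p \<sigma>2 f (W \<omega>)) = 0)"
  proof
    assume "distr M borel W = distr N borel Y"
    then show "\<forall>f \<in> stein_class p (PN_coeff p \<sigma>2) N Y.
            integrable M (\<lambda>\<omega>. PN_op p \<sigma>2 f (W \<omega>)) \<and>
            integral\<^sup>L M (\<lambda>\<omega>. PN_op p \<sigma>2 f (W \<omega>)) = 0"
      using law_Y law_W cd by metis
  next
    assume *: "\<forall>f \<in> stein_class p (PN_coeff p \<sigma>2) N Y.
            integrable M (\<lambda>\<omega>. PN_op p \<sigma>2 f (W \<omega>)) \<and>
            integral\<^sup>L M (\<lambda>\<omega>. PN_op p \<sigma>2 f (W \<omega>)) = 0"
    show "distr M borel W = distr N borel Y"
    \<comment> \<open>The law of \<open>Y\<close> solves the equations as well, by the necessity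
      part, so two solutions are compared.\<close>
    proof (rule stein_equation_unique[OF _ _ _ _ p s2])
      show "prob_space (distr M borel W)" "prob_space (distr N borel Y)"
        using assms(8) X(1) by (auto intro: prob_space.prob_space_distr)
      fix Q f assume "Q \<in> {distr M borel W, distr N borel Y}" and "f \<in> stein_tests p"
      then show "integrable Q (PN_op p \<sigma>2 f) \<and> (\<integral>y. PN_op p \<sigma>2 f y \<partial>Q) = 0"
        using * law_Y law_W cd sub by blast
    qed auto
  qed
  then show ?thesis
    by blast
qed

end
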